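(* Let $\lambda\in(0,1)$. For every $\varepsilon>0$ we have, for all $X\ge 1$, \[N_\lambda(X)\ll_{\varepsilon,\lambda}X^{0.6+\varepsilon},\] where the implied constant depends only on $\varepsilon$ and $\lambda$.
   Context: For a non-zero integer $n$, $\operatorname{rad}(n)=\prod_{p\mid n}p$ is the product of the distinct primes dividing $n$. For $\lambda>0$, a triple $(a,b,c)$ of positive integers with $\gcd(a,b,c)=1$ is called an $abc$ triple of exponent $\lambda$ if $a+b=c$ and $\operatorname{rad}(abc)<c^\lambda$. $N_\lambda(X)$ denotes the number of $abc$ triples of exponent $\lambda$ with $(a,b,c)\in[1,X]^3$. The notation $f\ll_{\varepsilon,\lambda} g$ means $|f|\le K g$ for a constant $K$ depending only on the subscripted parameters. *)

theory Defs
  imports Complex_Main "HOL-Computational_Algebra.Primes"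
begin

text \<open>
  The library's primes are normalized, so on \<open>int\<close> the product runs over the positive primes
  dividing \<open>n\<close>. Only \<open>n \<noteq> 0\<close> is meaningful.
\<close>

definition rad :: "'a :: factorial_semiring \<Rightarrow> 'a" where
  "rad n = (\<Prod>p\<in>prime_factors n. p)"

definition abc_triple :: "real \<Rightarrow> nat \<Rightarrow> nat \<Rightarrow> nat \<Rightarrow> bool" where
  "abc_triple l a b c \<longleftrightarrow>
     a > 0 \<and> b > 0 \<and> c > 0 \<and> Gcd {a, b, c} = 1 \<and> a + b = c \<and>
     real (rad (a * b * c)) < real c powr l"

definition abc_count :: "real \<Rightarrow> real \<Rightarrow> nat" where
  "abc_count l X =
     card {(a, b, c). abc_triple l a b c \<and>
       real a \<in> {1..X} \<and> real b \<in> {1..X} \<and> real c \<in> {1..X}}"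

end

theory Submission
  imports Defs "HOL-Analysis.Convex"
begin

text \<open>
  Split \<open>n = x\<^sub>1 x\<^sub>2\<^sup>2 x\<^sub>3\<^sup>3 x\<^sub>4\<^sup>4 t\<close> according to the multiplicities of its primes, where all
  primes of \<open>t\<close> have multiplicity at least \<open>5\<close>. It suffices to count the triples all of whose
  parts have prescribed sizes up to a factor \<open>2\<close>. Two bounds are used. First, fixing some
  of the parts turns the equation into \<open>A u\<^sup>k \<plusminus> B v\<^sup>k = \<plusminus>C w\<close> with \<open>k \<le> 3\<close>. Modulo \<open>C\<close> the ratio
  \<open>u/v\<close> lies in few residue classes, so \<open>(u, v)\<close> is a primitive point of one of few lattices of
  determinant about \<open>C\<close>, while the sizes confine \<open>u/v\<close> to a short interval. Up to \<open>Y\<^sup>\<epsilon>\<close> this leaves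
  \<open>1 + u v w / Y\<close> solutions, \<open>Y\<close> being the largest of the three numbers. Second, with
  \<open>A u\<^sup>3 \<plusminus> B v\<^sup>2\<close> equal to one of the three numbers, Cauchy-Schwarz and the divisor bound for differences
  of powers give a square-root saving in \<open>u\<close>, \<open>v\<close> and that number. Since the radical is less than
  \<open>Y\<close>, the sizes satisfy linear constraints on the logarithmic scale, and a linear
  programme shows that one of these bounds always has exponent at most \<open>0.6\<close>.
\<close>

section \<open>Integers with prescribed prime factors\<close>

text \<open>A number up to \<open>Y\<close> with prescribed prime support can be chosen in only
  Y^eps ways, so the price of fixing a part is its radical, not its size. Fixing two of the three
  numbers determines the third; as the product of the radicals is below \<open>Y\<close>, this alone
  gives exponent 2/3. If the three radicals are of comparable size, fixing two whole numbers is too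
  expensive, and parts must stay variable in a way that the equation still restricts. The lattice
  bound needs one exponent \<open>k\<close> for both variables, since only then does the equation
  modulo \<open>C\<close> see u/v alone. A cube in one number facing a square in another is out of
  its reach, and this is what the second bound is for. Multiplicities 1 to 4 are kept apart because
  squares, fourth powers and cubes supply k-th powers with k = 2, 3. From 5 on, the inequality
  radical^5 <= part, which keeps the radical below Y^(1/5), is all that the linear programme
  uses.\<close>

lemma card_below_finite: "finite {p::nat. real p < B}"
proof -
  have "{p::nat. real p < B} \<subseteq> {..nat \<lceil>B\<rceil>}"
    by (auto simp: le_nat_iff) (metis ceiling_mono ceiling_of_nat less_eq_real_def)
  thus ?thesis using finite_subset by blast
qed

text \<open>Source of the uniform constants: an Euler-type product whose factors are 1 from
  \<open>B\<close> on never exceeds its value over all p < \<open>B\<close>, whatever set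
  \<open>P\<close> it runs over.\<close>

lemma prod_mostly_one_bounded:
  fixes f :: "nat \<Rightarrow> real"
  assumes "\<And>p. 1 \<le> f p" "\<And>p. B \<le> real p \<Longrightarrow> f p = 1"
  shows "\<exists>M\<ge>1. \<forall>P. finite P \<longrightarrow> (\<Prod>p\<in>P. f p) \<le> M"
proof (intro exI[of _ "\<Prod>p\<in>{p. real p < B}. f p"] conjI allI impI)
  show "1 \<le> (\<Prod>p\<in>{p. real p < B}. f p)"
    using assms(1) by (intro prod_ge_1) auto
  fix P :: "nat set" assume P: "finite P"
  have "(\<Prod>p\<in>P. f p) = (\<Prod>p\<in>P \<inter> {p. real p < B}. f p)"
    using P assms(2) by (intro prod.mono_neutral_right) (auto simp: not_less)
  also have "\<dots> \<le> (\<Prod>p\<in>{p. real p < B}. f p)"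
    using assms(1) card_below_finite
    by (intro prod_mono2) (auto intro: order_trans[OF zero_le_one])
  finally show "(\<Prod>p\<in>P. f p) \<le> (\<Prod>p\<in>{p. real p < B}. f p)" .
qed

text \<open>A prime with p^e >= 2 pays for its factor 2 out of n^e. The finitely many smaller
  primes, those below 2^(1/e), are absorbed in \<open>M\<close>.\<close>

lemma two_pow_omega_bound:
  fixes e :: real
  assumes "e > 0"
  shows "\<exists>M>0. \<forall>n::nat. n > 0 \<longrightarrow> 2 ^ card (prime_factors n) \<le> M * real n powr e"
proof -
  define f :: "nat \<Rightarrow> real" where "f p = (if real p < 2 powr (1/e) then 2 else 1)" for p
  have "\<exists>M\<ge>1. \<forall>P. finite P \<longrightarrow> (\<Prod>p\<in>P. f p) \<le> M"
    by (rule prod_mostly_one_bounded[of f "2 powr (1/e)"]) (auto simp: f_def)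
  then obtain M where M: "M \<ge> 1" "\<And>P. finite P \<Longrightarrow> (\<Prod>p\<in>P. f p) \<le> M"
    by blast
  have "2 ^ card (prime_factors n) \<le> M * real n powr e" if n: "n > 0" for n :: nat
  proof -
    let ?P = "prime_factors n"
    have step: "2 \<le> f p * real p powr e" if "p \<in> ?P" for p
    proof -
      have p: "1 \<le> real p" using that by (auto simp: in_prime_factors_iff prime_ge_1_nat)
      show ?thesis
      proof (cases "real p < 2 powr (1/e)")
        case True
        thus ?thesis using p assms by (auto simp: f_def ge_one_powr_ge_zero)
      next
        case False
        hence "(2 powr (1/e)) powr e \<le> real p powr e"
          using assms by (intro powr_mono2) auto
        thus ?thesis using False assms by (simp add: f_def powr_powr)
      qed
    qed
    have pr: "(\<Prod>p\<in>?P. p) \<le> n"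
    proof -
      have "(\<Prod>p\<in>?P. p) dvd (\<Prod>p\<in>?P. p ^ multiplicity p n)"
        by (intro prod_dvd_prod) (auto simp: prime_factors_multiplicity dvd_power)
      also have "\<dots> = n" using n by (simp flip: prime_factorization_nat)
      finally show ?thesis using n by (simp add: dvd_imp_le)
    qed
    have "2 ^ card ?P = (\<Prod>p\<in>?P. (2::real))" by simp
    also have "\<dots> \<le> (\<Prod>p\<in>?P. f p * real p powr e)" using step by (intro prod_mono) auto
    also have "\<dots> = (\<Prod>p\<in>?P. f p) * (\<Prod>p\<in>?P. real p) powr e"
      by (simp add: prod.distrib prod_powr_distrib)
    also have "\<dots> \<le> M * real n powr e"
    proof (intro mult_mono powr_mono2)
      show "(\<Prod>p\<in>?P. real p) \<le> real n" using pr unfolding of_nat_prod[symmetric] of_nat_le_iff .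
    qed (use M(1) M(2)[of ?P] assms in \<open>auto intro: prod_nonneg\<close>)
    finally show ?thesis .
  qed
  thus ?thesis using M(1) by (intro exI[of _ M]) auto
qed

lemma sum_geometric_le:
  fixes q :: real
  assumes "0 < q" "q < 1"
  shows "(\<Sum>j\<in>{1..n}. q ^ j) \<le> q / (1 - q)"
proof -
  have "(\<Sum>j\<in>{1..n}. q ^ j) = (\<Sum>j<n. q ^ Suc j)"
    by (rule sum.reindex_bij_witness[of _ Suc "\<lambda>j. j - 1"]) auto
  also have "\<dots> = q * (\<Sum>j<n. q ^ j)" by (simp add: sum_distrib_left)
  also have "\<dots> = q * ((1 - q ^ n) / (1 - q))" using assms by (simp add: sum_gp_strict)
  also have "\<dots> \<le> q * (1 / (1 - q))"
    using assms by (intro mult_left_mono divide_right_mono) auto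
  finally show ?thesis by simp
qed

text \<open>Rankin's bound by induction on \<open>P\<close>. Splitting off the exact power p^j
  replaces \<open>X\<close> by X / p^j, and the resulting factors p^(-j*e) with j >= 1 sum to at
  most 1 / (p^e - 1). The maximum with 1 gives the product the form that
  \<open>prod_mostly_one_bounded\<close> expects.\<close>

lemma card_prime_support_le:
  fixes e :: real
  assumes e: "e > 0" and "finite P" "\<And>p. p \<in> P \<Longrightarrow> prime p"
  shows "real (card {m::nat. m > 0 \<and> real m \<le> X \<and> prime_factors m = P})
           \<le> (\<Prod>p\<in>P. max 1 (1 / (real p powr e - 1))) * max 0 X powr e"
  using assms(2,3)
proof (induction P arbitrary: X rule: finite_induct)
  case empty
  have "{m::nat. m > 0 \<and> real m \<le> X \<and> prime_factors m = {}} \<subseteq> (if X \<ge> 1 then {1} else {})"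
    by (auto simp: prime_factorization_empty_iff)
  hence "card {m::nat. m > 0 \<and> real m \<le> X \<and> prime_factors m = {}}
      \<le> card (if X \<ge> 1 then {1::nat} else {})"
    by (intro card_mono) auto
  also have "real \<dots> \<le> max 0 X powr e" using e by (auto simp: ge_one_powr_ge_zero)
  finally show ?case by simp
next
  case (insert p P)
  define c where "c = (\<Prod>p\<in>P. max 1 (1 / (real p powr e - 1)))"
  define q where "q = 1 / real p powr e"
  have p: "prime p" and p2: "real p \<ge> 2" using insert.prems prime_ge_2_nat by fastforce+
  have c0: "c \<ge> 0" unfolding c_def by (intro prod_nonneg) auto
  have "1 < real p powr e" using p2 e by (simp add: gr_one_powr)
  hence q: "0 < q" "q < 1" unfolding q_def using p2 by (auto simp: field_simps)
  \<comment> \<open>A bound for the multiplicity of \<open>p\<close>, since j < p^j <= m <=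
    \<open>X\<close>; it makes the union over j finite.\<close>
  define E where "E = nat \<lceil>X\<rceil>"
  let ?T = "\<lambda>X P. {m::nat. m > 0 \<and> real m \<le> X \<and> prime_factors m = P}"
  have finT: "finite (?T X P)" for X P
    by (rule finite_subset[of _ "{..nat \<lceil>X\<rceil>}"]) (auto simp: le_nat_iff, linarith)
  have sub: "?T X (insert p P) \<subseteq> (\<Union>j\<in>{1..E}. (\<lambda>m. p ^ j * m) ` ?T (X / real p ^ j) P)"
  proof
    fix m assume "m \<in> ?T X (insert p P)"
    hence m: "m > 0" "real m \<le> X" "prime_factors m = insert p P" by auto
    define j where "j = multiplicity p m"
    obtain m' where m': "m = p ^ j * m'" "\<not> p dvd m'"
      unfolding j_def by (rule multiplicity_decompose'[of m p]) (use m p not_prime_unit in auto)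
    have "p \<in> prime_factors m" using m by auto
    hence j1: "j \<ge> 1" unfolding j_def
      by (auto simp: prime_factors_multiplicity)
    have m'0: "m' > 0" using m m' by (cases "m'=0") auto
    have "prime_factors m = prime_factors (p^j) \<union> prime_factors m'"
      using m' m'0 p by (simp add: prime_factors_product prime_gt_0_nat)
    also have "prime_factors (p^j) = {p}" using p j1 by (simp add: prime_factorization_prime_power)
    finally have pf: "prime_factors m' = P"
      using m(3) m'(2) insert.hyps by (auto simp: in_prime_factors_iff)
    have "j < p ^ j" using prime_gt_1_nat[OF p] by (simp add: power_gt_expt)
    also have "p ^ j \<le> m" using m' m'0 by auto
    finally have "real j \<le> X" using m(2) by linarith
    hence jE: "j \<le> E" unfolding E_def by linarith
    have "real m' \<le> X / real p ^ j"
      using m(2) m' p2 by (simp add: field_simps)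
    thus "m \<in> (\<Union>j\<in>{1..E}. (\<lambda>m. p ^ j * m) ` ?T (X / real p ^ j) P)"
      using j1 jE m'0 pf m' by auto
  qed
  have "card (?T X (insert p P)) \<le> card (\<Union>j\<in>{1..E}. (\<lambda>m. p ^ j * m) ` ?T (X / real p ^ j) P)"
    using sub finT by (intro card_mono) auto
  also have "\<dots> \<le> (\<Sum>j\<in>{1..E}. card ((\<lambda>m. p ^ j * m) ` ?T (X / real p ^ j) P))"
    by (intro card_UN_le) auto
  also have "\<dots> \<le> (\<Sum>j\<in>{1..E}. card (?T (X / real p ^ j) P))"
    using finT by (intro sum_mono card_image_le) auto
  finally have "real (card (?T X (insert p P))) \<le> (\<Sum>j\<in>{1..E}. real (card (?T (X / real p ^ j) P)))"
    unfolding of_nat_sum[symmetric] of_nat_le_iff .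
  also have "\<dots> \<le> (\<Sum>j\<in>{1..E}. c * max 0 (X / real p ^ j) powr e)"
    unfolding c_def using insert.IH insert.prems by (intro sum_mono) auto
  also have "\<dots> = (\<Sum>j\<in>{1..E}. (c * max 0 X powr e) * q ^ j)"
  proof (intro sum.cong refl)
    fix j
    have "max 0 (X / real p ^ j) = max 0 X / real p ^ j" using p2 by (auto simp: max_def field_simps)
    hence "max 0 (X / real p ^ j) powr e = max 0 X powr e / (real p ^ j) powr e"
      using p2 by (simp add: powr_divide)
    also have "(real p ^ j) powr e = (real p powr e) ^ j"
      using p2 powr_powr_swap[of "real p" "real j" e] by (simp add: powr_realpow)
    finally show "c * max 0 (X / real p ^ j) powr e = (c * max 0 X powr e) * q ^ j"
      by (simp add: q_def power_divide)
  qed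
  also have "\<dots> = (c * max 0 X powr e) * (\<Sum>j\<in>{1..E}. q ^ j)" by (simp add: sum_distrib_left)
  also have "\<dots> \<le> (c * max 0 X powr e) * (q / (1 - q))"
    using sum_geometric_le[OF q] c0 by (intro mult_left_mono) auto
  also have "q / (1 - q) = 1 / (real p powr e - 1)"
    using q p2 by (simp add: q_def field_simps)
  also have "(c * max 0 X powr e) * (1 / (real p powr e - 1))
      \<le> (c * max 0 X powr e) * max 1 (1 / (real p powr e - 1))"
    using c0 by (intro mult_left_mono) auto
  finally show ?case using insert.hyps by (simp add: c_def mult_ac)
qed

text \<open>Uniform in \<open>P\<close>, because 1 / (p^e - 1) exceeds 1 only for the finitely many
  primes with p^e < 2. This is the reason why fixing a radical leaves few numbers.\<close>

lemma card_prime_support_bound: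
  fixes e :: real
  assumes e: "e > 0"
  shows "\<exists>M>0. \<forall>X>0. \<forall>P. real (card {m::nat. m > 0 \<and> real m \<le> X \<and> prime_factors m = P}) \<le> M * X powr e"
proof -
  define f where "f p = max 1 (1 / (max 2 (real p) powr e - 1))" for p :: nat
  have "f p = 1" if "2 powr (1/e) + 2 \<le> real p" for p
  proof -
    have "(2 powr (1/e)) powr e \<le> real p powr e" using that e by (intro powr_mono2) auto
    hence "2 \<le> real p powr e" using e by (simp add: powr_powr)
    moreover have "max 2 (real p) = real p"
      using that powr_ge_zero[of 2 "1/e"] by linarith
    ultimately show ?thesis unfolding f_def by (simp add: field_simps max_def)
  qed
  then obtain M where M: "M \<ge> 1" "\<And>P. finite P \<Longrightarrow> (\<Prod>p\<in>P. f p) \<le> M"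
    using prod_mostly_one_bounded[of f "2 powr (1/e) + 2"] by (auto simp: f_def)
  have "real (card {m::nat. m > 0 \<and> real m \<le> X \<and> prime_factors m = P}) \<le> M * X powr e" (is "?L \<le> _")
    if X: "X > 0" for X P
  proof (cases "\<exists>m::nat. m > 0 \<and> prime_factors m = P")
    case False
    hence *: "{m::nat. m > 0 \<and> real m \<le> X \<and> prime_factors m = P} = {}" by blast
    show ?thesis using M(1) unfolding * by simp
  next
    case True
    hence P: "finite P" "\<And>p. p \<in> P \<Longrightarrow> prime p" by auto
    have "?L \<le> (\<Prod>p\<in>P. max 1 (1 / (real p powr e - 1))) * max 0 X powr e"
      using card_prime_support_le[OF e P] by blast
    also have "(\<Prod>p\<in>P. max 1 (1 / (real p powr e - 1))) = (\<Prod>p\<in>P. f p)"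
    proof (intro prod.cong refl)
      fix p assume "p \<in> P"
      hence "real p \<ge> 2" using P(2) prime_ge_2_nat by fastforce
      thus "max 1 (1 / (real p powr e - 1)) = f p" by (simp add: f_def max_def)
    qed
    also have "\<dots> * max 0 X powr e \<le> M * X powr e"
      using M(1) M(2)[OF P(1)] X by (intro mult_mono) auto
    finally show ?thesis .
  qed
  thus ?thesis using M(1) by (intro exI[of _ M]) auto
qed

text \<open>A divisor of \<open>n\<close> is chosen by its set of primes, one of the 2^omega(n)
  subsets, and then among the few numbers up to \<open>n\<close> with that support.\<close>

lemma divisor_count_bound:
  fixes e :: real
  assumes e: "e > 0"
  shows "\<exists>M>0. \<forall>n::nat. n > 0 \<longrightarrow> real (card {d. d dvd n}) \<le> M * real n powr e"
proof -
  obtain M1 where M1: "M1 > 0" "\<And>n::nat. n > 0 \<Longrightarrow> 2 ^ card (prime_factors n) \<le> M1 * real n powr (e/2)"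
    using two_pow_omega_bound[of "e/2"] e by auto
  obtain M2 where M2: "M2 > 0" "\<And>X P. X > 0 \<Longrightarrow>
      real (card {m::nat. m > 0 \<and> real m \<le> X \<and> prime_factors m = P}) \<le> M2 * X powr (e/2)"
    using card_prime_support_bound[of "e/2"] e by auto
  have "real (card {d. d dvd n}) \<le> (M1 * M2) * real n powr e" if n: "n > 0" for n :: nat
  proof -
    let ?T = "\<lambda>P. {m::nat. m > 0 \<and> real m \<le> real n \<and> prime_factors m = P}"
    have fin: "finite (?T P)" for P by (rule finite_subset[of _ "{..n}"]) auto
    have "{d. d dvd n} \<subseteq> (\<Union>P\<in>Pow (prime_factors n). ?T P)"
    proof
      fix d assume "d \<in> {d. d dvd n}"
      hence d: "d dvd n" by simp
      hence "d > 0" "d \<le> n" using n by (auto intro: dvd_imp_le Nat.gr0I)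
      moreover have "prime_factors d \<subseteq> prime_factors n" using n d by (intro dvd_prime_factors) auto
      ultimately show "d \<in> (\<Union>P\<in>Pow (prime_factors n). ?T P)" by auto
    qed
    hence "card {d. d dvd n} \<le> card (\<Union>P\<in>Pow (prime_factors n). ?T P)"
      using fin by (intro card_mono) auto
    also have "\<dots> \<le> (\<Sum>P\<in>Pow (prime_factors n). card (?T P))"
      by (intro card_UN_le) auto
    finally have "real (card {d. d dvd n}) \<le> (\<Sum>P\<in>Pow (prime_factors n). real (card (?T P)))"
      unfolding of_nat_sum[symmetric] of_nat_le_iff .
    also have "\<dots> \<le> (\<Sum>P\<in>Pow (prime_factors n). M2 * real n powr (e/2))"
      using M2(2)[of "real n"] n by (intro sum_mono) auto
    also have "\<dots> = 2 ^ card (prime_factors n) * (M2 * real n powr (e/2))"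
      by (simp add: card_Pow)
    also have "\<dots> \<le> (M1 * real n powr (e/2)) * (M2 * real n powr (e/2))"
      using M1(2)[OF n] M2(1) by (intro mult_right_mono) auto
    also have "\<dots> = (M1 * M2) * (real n powr (e/2) * real n powr (e/2))"
      by (simp only: mult_ac)
    also have "real n powr (e/2) * real n powr (e/2) = real n powr e"
      using powr_add[of "real n" "e/2" "e/2"] by simp
    finally show ?thesis .
  qed
  thus ?thesis using mult_pos_pos[OF M1(1) M2(1)] by blast
qed

section \<open>Roots of unity modulo C and points of small lattices\<close>

text \<open>Glues congruences modulo two factors of \<open>C\<close> that are not quite coprime; the
  price is a bounded multiplier \<open>g\<close>, which below is 2 or 3.\<close>

lemma mult_dvd_gcd_mult:
  fixes a b x g :: int
  assumes "a dvd x" "b dvd x" "gcd a b dvd g"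
  shows "a * b dvd g * x"
proof -
  have "gcd a b * lcm a b dvd g * x"
    using assms by (intro mult_dvd_mono lcm_least)
  moreover have "a * b dvd gcd a b * lcm a b" by (simp add: gcd_mult_lcm flip: abs_mult)
  ultimately show ?thesis by (rule dvd_trans[rotated])
qed

lemma div_gcd_dvd:
  fixes C x y :: int
  assumes "C dvd x * y" "C > 0"
  shows "C div gcd C x dvd y"
proof -
  let ?d = "gcd C x"
  have d: "?d > 0" using assms by auto
  obtain C' x' where C': "C = ?d * C'" "x = ?d * x'"
    by (meson gcd_dvd1 gcd_dvd2 dvdE)
  have "coprime (C div ?d) (x div ?d)" using assms(2) by (intro div_gcd_coprime) auto
  moreover have "C div ?d = C'" "x div ?d = x'" using C' d by (metis nonzero_mult_div_cancel_left less_irrefl)+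
  ultimately have co: "coprime C' x'" by simp
  have "?d * C' dvd ?d * (x' * y)" using assms(1) C' by (metis mult.assoc)
  hence "C' dvd x' * y" using d by (metis dvd_mult_cancel_left less_irrefl)
  hence "C' dvd y" using co by (simp add: coprime_dvd_mult_right_iff)
  thus ?thesis using \<open>C div ?d = C'\<close> by simp
qed

lemma dvd_coprime_cancel:
  fixes D C c x :: int
  assumes "D dvd c * x" "D dvd C" "coprime c C"
  shows "D dvd x"
  using assms by (meson coprime_commute coprime_divisors coprime_dvd_mult_right_iff dvd_refl)

text \<open>The ratio T = (u v0)/(u0 v) satisfies T^2 = 1 modulo \<open>C\<close>. If D is the gcd
  of \<open>C\<close> with T - 1, then T = 1 modulo D and T = -1 modulo C/D. So D alone fixes T, up
  to the common divisor of D and C/D, which divides 2.\<close>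

lemma square_root_class:
  fixes u v u' v' u0 v0 C :: int
  assumes C: "C > 0"
    and co: "coprime u C" "coprime v0 C"
    and sq: "C dvd (u * v0)^2 - (u0 * v)^2" "C dvd (u' * v0)^2 - (u0 * v')^2"
    and eq: "gcd C (u * v0 - u0 * v) = gcd C (u' * v0 - u0 * v')"
  shows "C dvd 2 * (u * v' - u' * v)"
proof -
  define D where "D = gcd C (u * v0 - u0 * v)"
  define E where "E = C div D"
  have DE: "D * E = C" unfolding D_def E_def by simp
  have DE: "D * E = C" "D dvd C" "E dvd C" using DE by auto
  have D1: "D dvd u * v0 - u0 * v" and D2: "D dvd u' * v0 - u0 * v'"
    unfolding D_def by (simp, unfold eq, simp)
  have "C dvd (u * v0 - u0 * v) * (u * v0 + u0 * v)"
    using sq(1) by (simp add: power2_eq_square algebra_simps)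
  from div_gcd_dvd[OF this C] have E1: "E dvd u * v0 + u0 * v" by (simp add: E_def D_def)
  have "C dvd (u' * v0 - u0 * v') * (u' * v0 + u0 * v')"
    using sq(2) by (simp add: power2_eq_square algebra_simps)
  from div_gcd_dvd[OF this C] have E2: "E dvd u' * v0 + u0 * v'" using eq by (simp add: E_def D_def)
  have "D dvd v' * (u * v0 - u0 * v) - v * (u' * v0 - u0 * v')"
    using D1 D2 by (rule dvd_diff[OF dvd_mult dvd_mult])
  also have "\<dots> = v0 * (u * v' - u' * v)" by (simp add: algebra_simps)
  finally have D3: "D dvd u * v' - u' * v" using DE(2) co(2) by (rule dvd_coprime_cancel)
  have "E dvd v' * (u * v0 + u0 * v) - v * (u' * v0 + u0 * v')"
    using E1 E2 by (rule dvd_diff[OF dvd_mult dvd_mult])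
  also have "\<dots> = v0 * (u * v' - u' * v)" by (simp add: algebra_simps)
  finally have E3: "E dvd u * v' - u' * v" using DE(3) co(2) by (rule dvd_coprime_cancel)
  have "gcd D E dvd (u * v0 - u0 * v) + (u * v0 + u0 * v)"
    using D1 E1 by (meson dvd_add dvd_trans gcd_dvd1 gcd_dvd2)
  also have "\<dots> = (u * v0) * 2" by simp
  finally have "gcd D E dvd 2"
    using DE(2) co by (intro dvd_coprime_cancel[of "gcd D E" "u * v0" 2 C]) (auto intro: dvd_trans)
  hence "D * E dvd 2 * (u * v' - u' * v)" using D3 E3 by (intro mult_dvd_gcd_mult)
  thus ?thesis using DE by simp
qed

text \<open>
  With \<open>T = (u v0)/(u0 v)\<close> a residue of \<open>T\<^sup>3 - 1 = (T - 1)(T\<^sup>2 + T + 1)\<close>: the common divisor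
  with the linear factor is recorded first, and on the quadratic part the factorization
  \<open>(T - T')(T + T' + 1)\<close> with a second base point \<open>(p, q)\<close> finishes the job.
\<close>

lemma cube_root_class:
  fixes u v u' v' u0 v0 p q C :: int
  assumes C: "C > 0"
    and co: "coprime v C" "coprime v' C" "coprime u0 C" "coprime v0 C" "coprime q C"
    and cu: "C dvd (u * v0)^3 - (u0 * v)^3" "C dvd (u' * v0)^3 - (u0 * v')^3"
      "C dvd (p * v0)^3 - (u0 * q)^3"
    and D: "gcd C (u * v0 - u0 * v) = D" "gcd C (u' * v0 - u0 * v') = D" "gcd C (p * v0 - u0 * q) = D"
    and E: "E = C div D" "gcd E (u * q - p * v) = D'" "gcd E (u' * q - p * v') = D'"
  shows "C dvd 9 * (u * v' - u' * v)"
proof -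
  have DE: "D * E = C" using D(1) unfolding E(1) by auto
  have DE: "D * E = C" "D dvd C" "E dvd C" using DE by auto
  have E0: "E > 0" using C DE(1) D(1)
    by (metis gcd_ge_0_int zero_less_mult_pos order_le_less mult_zero_left less_irrefl)
  have D1: "D dvd u * v0 - u0 * v" "D dvd u' * v0 - u0 * v'" 
    by (fact gcd_dvd2[of C "u * v0 - u0 * v", unfolded D]
      gcd_dvd2[of C "u' * v0 - u0 * v'", unfolded D])+
  define N where "N u v = u^2 * v0^2 + u * v0 * u0 * v + u0^2 * v^2" for u v
  have fac: "(u * v0)^3 - (u0 * v)^3 = (u * v0 - u0 * v) * N u v" for u v
    by (simp add: N_def power3_eq_cube power2_eq_square algebra_simps)
  have EN: "E dvd N u v" "E dvd N u' v'" "E dvd N p q"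
    using div_gcd_dvd[OF cu(1)[unfolded fac] C] div_gcd_dvd[OF cu(2)[unfolded fac] C]
      div_gcd_dvd[OF cu(3)[unfolded fac] C] D E(1) by auto
  \<comment> \<open>With T = (u v0)/(u0 v) and T' = (p v0)/(u0 q), this is T + T' + 1 after clearing
    denominators; \<open>u * q - p * v\<close> plays the role of T - T'.\<close>
  define R where "R u v = v0 * (u * q + p * v) + u0 * v * q" for u v
  have R: "E dvd (u * q - p * v) * R u v" if "E dvd N u v" for u v
  proof -
    have "E dvd q^2 * N u v - v^2 * N p q" using that EN(3) by (rule dvd_diff[OF dvd_mult dvd_mult])
    also have "\<dots> = v0 * ((u * q - p * v) * R u v)"
      by (simp add: N_def R_def power2_eq_square algebra_simps)
    finally show ?thesis using DE(3) co(4) by (rule dvd_coprime_cancel)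
  qed
  define E' where "E' = E div D'"
  have DE': "D' * E' = E" using E(2) unfolding E'_def by auto
  have DE': "D' * E' = E" "D' dvd E" "E' dvd E" using DE' by auto
  have E'R: "E' dvd R u v" "E' dvd R u' v'"
    using div_gcd_dvd[OF R[OF EN(1)] E0] div_gcd_dvd[OF R[OF EN(2)] E0] E by (auto simp: E'_def)
  have D'1: "D' dvd u * q - p * v" "D' dvd u' * q - p * v'" 
    by (fact gcd_dvd2[of E "u * q - p * v", unfolded E(2,3)]
      gcd_dvd2[of E "u' * q - p * v'", unfolded E(2,3)])+
  have "D dvd v' * (u * v0 - u0 * v) - v * (u' * v0 - u0 * v')"
    using D1 by (rule dvd_diff[OF dvd_mult dvd_mult])
  also have "\<dots> = v0 * (u * v' - u' * v)" by (simp add: algebra_simps)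
  finally have D3: "D dvd u * v' - u' * v" using DE(2) co(4) by (rule dvd_coprime_cancel)
  have "D' dvd v' * (u * q - p * v) - v * (u' * q - p * v')"
    using D'1 by (rule dvd_diff[OF dvd_mult dvd_mult])
  also have "\<dots> = q * (u * v' - u' * v)" by (simp add: algebra_simps)
  finally have D'3: "D' dvd u * v' - u' * v"
    using dvd_trans[OF DE'(2) DE(3)] co(5) by (rule dvd_coprime_cancel)
  have "E' dvd v' * R u v - v * R u' v'" using E'R by (rule dvd_diff[OF dvd_mult dvd_mult])
  also have "\<dots> = (v0 * q) * (u * v' - u' * v)" by (simp add: R_def algebra_simps)
  finally have E'3: "E' dvd u * v' - u' * v"
    using dvd_trans[OF DE'(3) DE(3)] by (rule dvd_coprime_cancel) (simp add: co)
  \<comment> \<open>Modulo this gcd both T = T' and T + T' + 1 = 0, so 2T' + 1 = 0 and T' is a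
    double root of T^2 + T + 1, whose discriminant is -3. The identity used is 4(T'^2 + T' + 1) -
    (2T' + 1)^2 = 3.\<close>
  have "gcd D' E' dvd 3"
  proof -
    let ?g = "gcd D' E'"
    have g: "?g dvd C" using DE'(2) DE(3) by (meson dvd_trans gcd_dvd1)
    have "?g dvd R u v - v0 * (u * q - p * v)"
      using E'R(1) D'1(1) by (meson dvd_diff dvd_mult dvd_trans gcd_dvd1 gcd_dvd2)
    also have "\<dots> = v * (2 * v0 * p + u0 * q)" by (simp add: R_def algebra_simps)
    finally have "?g dvd 2 * v0 * p + u0 * q" using g co(1) by (rule dvd_coprime_cancel)
    moreover have "?g dvd N p q" using EN(3) DE'(2) by (meson dvd_trans gcd_dvd1)
    ultimately have "?g dvd 4 * N p q - (2 * v0 * p + u0 * q) * (2 * v0 * p + u0 * q)"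
      by (rule dvd_diff[OF dvd_mult dvd_mult, rotated])
    also have "\<dots> = (u0 * u0 * q * q) * 3" by (simp add: N_def power2_eq_square algebra_simps)
    finally show ?thesis
      using g by (rule dvd_coprime_cancel) (simp add: co)
  qed
  hence "D' * E' dvd 3 * (u * v' - u' * v)" using D'3 E'3 by (intro mult_dvd_gcd_mult)
  hence E3: "E dvd 3 * (u * v' - u' * v)" using DE' by simp
  \<comment> \<open>Here T = 1 is a root of T^2 + T + 1, whose value at 1 is 3. Together with the
    previous 3 this gives the multiplier 9.\<close>
  have "gcd D E dvd 3"
  proof -
    let ?g = "gcd D E"
    have g: "?g dvd C" using DE(2) by (meson dvd_trans gcd_dvd1)
    have "?g dvd u * v0 - u0 * v" using D1(1) by (meson dvd_trans gcd_dvd1)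
    moreover have "?g dvd N u v" using EN(1) by (meson dvd_trans gcd_dvd2)
    ultimately have "?g dvd N u v - (u * v0 + 2 * u0 * v) * (u * v0 - u0 * v)"
      by (rule dvd_diff[OF _ dvd_mult, rotated])
    also have "\<dots> = (u0 * u0 * v * v) * 3" by (simp add: N_def power2_eq_square algebra_simps)
    finally show ?thesis
      using g by (rule dvd_coprime_cancel) (simp add: co)
  qed
  hence "D * E dvd 3 * (3 * (u * v' - u' * v))"
    using dvd_mult[OF D3, of 3] E3 by (intro mult_dvd_gcd_mult)
  thus ?thesis using DE by simp
qed

text \<open>The label \<open>f\<close> consists of the gcds that \<open>square_root_class\<close>
  and \<open>cube_root_class\<close> ask for, so there are at most d(C)^2 labels, and points with
  equal labels lie in one lattice of index about \<open>C\<close>. The number 18 is a common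
  multiple of the multipliers 1, 2 and 9 for k = 1, 2, 3.\<close>

lemma root_classes:
  fixes S :: "(int \<times> int) set" and C :: int
  assumes k: "k \<in> {1,2,3::nat}" and C: "C > 0"
    and co: "\<And>u v. (u, v) \<in> S \<Longrightarrow> coprime u C \<and> coprime v C"
    and pw: "\<And>u v u' v'. (u, v) \<in> S \<Longrightarrow> (u', v') \<in> S \<Longrightarrow> C dvd (u * v')^k - (u' * v)^k"
  shows "\<exists>f. f ` S \<subseteq> {d. d > 0 \<and> d dvd C} \<times> {d. d > 0 \<and> d dvd C} \<and>
    (\<forall>u v u' v'. (u, v) \<in> S \<longrightarrow> (u', v') \<in> S \<longrightarrow> f (u, v) = f (u', v') \<longrightarrow> C dvd 18 * (u * v' - u' * v))"
proof (cases "S = {}")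
  case True
  thus ?thesis by auto
next
  case False
  then obtain u0 v0 where s0: "(u0, v0) \<in> S" by auto
  consider "k = 1" | "k = 2" | "k = 3" using k by auto
  thus ?thesis
  proof cases
    case 1
    have "C dvd 18 * (u * v' - u' * v)" if "(u, v) \<in> S" "(u', v') \<in> S" for u v u' v'
      using pw[OF that] unfolding 1 by (intro dvd_mult) simp
    thus ?thesis
      using C by (intro exI[of _ "\<lambda>_. (1, 1)"]) auto
  next
    case 2
    define f where "f = (\<lambda>(u, v). (gcd C (u * v0 - u0 * v), 1::int))"
    have "C dvd 18 * (u * v' - u' * v)"
      if "(u, v) \<in> S" "(u', v') \<in> S" "f (u, v) = f (u', v')" for u v u' v'
    proof -
      have "C dvd 2 * (u * v' - u' * v)"
      proof (rule square_root_class[OF C])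
        show "C dvd (u * v0)\<^sup>2 - (u0 * v)\<^sup>2" "C dvd (u' * v0)\<^sup>2 - (u0 * v')\<^sup>2"
          using pw[OF that(1) s0] pw[OF that(2) s0] 2 by auto
      qed (use co[OF that(1)] co[OF s0] that(3) in \<open>auto simp: f_def\<close>)
      hence "C dvd 9 * (2 * (u * v' - u' * v))" by (rule dvd_mult)
      thus ?thesis by simp
    qed
    thus ?thesis using C by (intro exI[of _ f]) (auto simp: f_def)
  next
    case 3
    define f1 where "f1 = (\<lambda>(u, v). gcd C (u * v0 - u0 * v))"
    \<comment> \<open>The second base point may depend on the first gcd \<open>D\<close> but on
      nothing else, so that two points with the same \<open>D\<close> are measured against the same
      (p, q).\<close>
    define b where "b D = (SOME s. s \<in> S \<and> f1 s = D)" for D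
    define f2 where "f2 = (\<lambda>(u, v). let D = f1 (u, v) in gcd (C div D) (u * snd (b D) - fst (b D) * v))"
    define f where "f s = (f1 s, f2 s)" for s
    have main: "C dvd 18 * (u * v' - u' * v)"
      if s: "(u, v) \<in> S" "(u', v') \<in> S" and eq: "f (u, v) = f (u', v')" for u v u' v'
    proof -
      define D where "D = f1 (u, v)"
      have D': "D = f1 (u', v')" using eq by (simp add: f_def D_def)
      obtain p q where pq: "b D = (p, q)" by force
      have "b D \<in> S \<and> f1 (b D) = D"
        unfolding b_def by (rule someI[of _ "(u, v)"]) (use s D_def in auto)
      hence b: "(p, q) \<in> S" "f1 (p, q) = D" using pq by auto
      have f2: "f2 (u, v) = f2 (u', v')" using eq by (simp add: f_def)
      have "C dvd 9 * (u * v' - u' * v)"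
      proof (rule cube_root_class[OF C])
        show "C dvd (u * v0) ^ 3 - (u0 * v) ^ 3" "C dvd (u' * v0) ^ 3 - (u0 * v') ^ 3"
          "C dvd (p * v0) ^ 3 - (u0 * q) ^ 3"
          using pw[OF s(1) s0] pw[OF s(2) s0] pw[OF b(1) s0] 3 by auto
        show "gcd C (u * v0 - u0 * v) = D" "gcd C (u' * v0 - u0 * v') = D" "gcd C (p * v0 - u0 * q) = D"
          using D_def D' b(2) by (auto simp: f1_def)
        show "gcd (C div D) (u' * q - p * v') = f2 (u', v')"
          using D' pq by (simp add: f2_def Let_def)
        show "gcd (C div D) (u * q - p * v) = f2 (u', v')"
          using D_def pq f2 by (simp add: f2_def Let_def)
      qed (use co[OF s(1)] co[OF s(2)] co[OF s0] co[OF b(1)] in auto)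
      hence "C dvd 2 * (9 * (u * v' - u' * v))" by (rule dvd_mult)
      thus ?thesis by simp
    qed
    have rng: "f ` S \<subseteq> {d. d > 0 \<and> d dvd C} \<times> {d. d > 0 \<and> d dvd C}"
    proof
      fix y assume "y \<in> f ` S"
      then obtain u v where y: "y = f (u, v)" by auto
      define D where "D = f1 (u, v)"
      have D: "D > 0" "D dvd C" using C by (auto simp: D_def f1_def)
      have "C div D > 0" using C D by (simp add: pos_imp_zdiv_pos_iff zdvd_imp_le)
      moreover have "f2 (u, v) dvd C div D" by (simp add: f2_def Let_def D_def)
      moreover have "C div D dvd C" using D by (simp add: div_dvd_iff_mult)
      moreover have "f2 (u, v) \<noteq> 0" using calculation(1,2) by auto
      moreover have "f2 (u, v) \<ge> 0" by (simp add: f2_def Let_def)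
      ultimately show "y \<in> {d. d > 0 \<and> d dvd C} \<times> {d. d > 0 \<and> d dvd C}"
        using D by (auto simp: y f_def D_def[symmetric] intro: dvd_trans)
    qed
    show ?thesis using main rng by (intro exI[of _ f]) auto
  qed
qed

section \<open>Spacing of slopes and size of determinants\<close>

lemma card_spaced_le:
  fixes T :: "real set"
  assumes fin: "finite T" and d: "d > 0" and L: "L \<ge> 0"
    and sp: "\<And>x y. x \<in> T \<Longrightarrow> y \<in> T \<Longrightarrow> x \<noteq> y \<Longrightarrow> d \<le> \<bar>x - y\<bar>"
    and di: "\<And>x y. x \<in> T \<Longrightarrow> y \<in> T \<Longrightarrow> \<bar>x - y\<bar> \<le> L"
  shows "real (card T) \<le> 1 + L / d"
proof (cases "T = {}")
  case True
  thus ?thesis using d L by simp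
next
  case False
  define m where "m = Min T"
  have m: "m \<in> T" "\<And>x. x \<in> T \<Longrightarrow> m \<le> x" using fin False by (auto simp: m_def)
  define g where "g x = nat \<lfloor>(x - m) / d\<rfloor>" for x
  have "inj_on g T"
  proof (rule inj_onI, rule ccontr)
    fix x y assume xy: "x \<in> T" "y \<in> T" "g x = g y" "x \<noteq> y"
    have "0 \<le> (x - m) / d" "0 \<le> (y - m) / d" using m(2) xy d by auto
    hence "\<lfloor>(x - m) / d\<rfloor> = \<lfloor>(y - m) / d\<rfloor>"
      using xy(3) unfolding g_def by (subst (asm) eq_nat_nat_iff) auto
    hence "\<bar>(x - m) / d - (y - m) / d\<bar> < 1" by linarith
    also have "(x - m) / d - (y - m) / d = (x - y) / d" by (simp add: diff_divide_distrib)
    finally have "\<bar>x - y\<bar> < d" using d by (simp add: abs_divide)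
    thus False using sp[OF xy(1,2,4)] by simp
  qed
  moreover have "g ` T \<subseteq> {..nat \<lfloor>L / d\<rfloor>}"
  proof
    fix y assume "y \<in> g ` T"
    then obtain x where x: "x \<in> T" "y = g x" by auto
    have "x - m \<le> L" using di[OF x(1) m(1)] by linarith
    hence "(x - m) / d \<le> L / d" using d by (simp add: divide_right_mono)
    thus "y \<in> {..nat \<lfloor>L / d\<rfloor>}" using x(2) by (auto simp: g_def intro!: nat_mono floor_mono)
  qed
  ultimately have "card T \<le> card {..nat \<lfloor>L / d\<rfloor>}" by (intro card_inj_on_le[of g]) auto
  hence "real (card T) \<le> 1 + real (nat \<lfloor>L / d\<rfloor>)" by simp
  also have "real (nat \<lfloor>L / d\<rfloor>) \<le> L / d" using d L by simp
  finally show ?thesis by simp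
qed

text \<open>Turns closeness of k-th powers into closeness of their bases: of the nonnegative
  summands of (x^k - y^k)/(x - y) only x^(k-1) is kept.\<close>

lemma abs_power_diff_ge:
  fixes x y :: real
  assumes "x \<ge> 0" "y \<ge> 0" "k > 0"
  shows "\<bar>x - y\<bar> * x ^ (k - 1) \<le> \<bar>x ^ k - y ^ k\<bar>"
proof -
  obtain n where k: "k = Suc n" using assms(3) gr0_implies_Suc by auto
  have "x ^ n = (\<Sum>p\<in>{n}. x ^ p * y ^ (n - p))" by simp
  also have "\<dots> \<le> (\<Sum>p<Suc n. x ^ p * y ^ (n - p))" using assms by (intro sum_mono2) auto
  finally have "\<bar>x - y\<bar> * x ^ n \<le> \<bar>x - y\<bar> * (\<Sum>p<Suc n. x ^ p * y ^ (n - p))"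
    by (intro mult_left_mono) auto
  also have "\<dots> = \<bar>x ^ Suc n - y ^ Suc n\<bar>"
    using assms by (simp only: diff_power_eq_sum abs_mult) (simp add: sum_nonneg)
  finally show ?thesis by (simp add: k)
qed

lemma card_int_divisors:
  assumes "C > 0"
  shows "finite {d::int. d > 0 \<and> d dvd int C}" "card {d::int. d > 0 \<and> d dvd int C} = card {d::nat. d dvd C}"
proof -
  have "{d::int. d > 0 \<and> d dvd int C} = int ` {d::nat. d dvd C}"
  proof (intro set_eqI iffI)
    fix d assume "d \<in> {d::int. d > 0 \<and> d dvd int C}"
    hence "d = int (nat d)" "nat d dvd C" by (auto simp: nat_dvd_iff)
    thus "d \<in> int ` {d::nat. d dvd C}" by blast
  qed (use assms in \<open>auto intro: Nat.gr0I\<close>)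
  moreover have "finite {d::nat. d dvd C}" using assms by simp
  ultimately show "finite {d::int. d > 0 \<and> d dvd int C}"
    "card {d::int. d > 0 \<and> d dvd int C} = card {d::nat. d dvd C}"
    by (auto simp: card_image)
qed

lemma card_le_fibres:
  assumes "finite S" "finite R" "f ` S \<subseteq> R" "\<And>c. c \<in> R \<Longrightarrow> real (card {s \<in> S. f s = c}) \<le> m"
  shows "real (card S) \<le> real (card R) * m"
proof -
  have "S = (\<Union>c\<in>R. {s \<in> S. f s = c})" using assms(3) by auto
  hence "card S \<le> (\<Sum>c\<in>R. card {s \<in> S. f s = c})"
    using card_UN_le[OF assms(2), of "\<lambda>c. {s \<in> S. f s = c}"] by simp
  hence "real (card S) \<le> (\<Sum>c\<in>R. real (card {s \<in> S. f s = c}))"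
    unfolding of_nat_sum[symmetric] of_nat_le_iff .
  also have "\<dots> \<le> (\<Sum>c\<in>R. m)" using assms(4) by (rule sum_mono)
  finally show ?thesis by simp
qed

lemma abs_cross_diff_le:
  fixes p q p' q' :: real
  assumes "0 \<le> p" "0 \<le> q" "0 \<le> p'" "0 \<le> q'" "p \<le> a" "p' \<le> a" "q \<le> b" "q' \<le> b"
  shows "\<bar>p * q' - p' * q\<bar> \<le> a * b"
proof -
  have "p * q' \<le> a * b" "p' * q \<le> a * b" using assms by (auto intro!: mult_mono)
  moreover have "0 \<le> p * q'" "0 \<le> p' * q" using assms by auto
  ultimately show ?thesis by linarith
qed

text \<open>Replacing a column of the determinant by the one of \<open>z\<close> changes at most its
  sign, so any two of the three scales bound it. The two are chosen to leave out a scale that is at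
  least \<open>M\<close>.\<close>

lemma cross_determinant_bound:
  fixes x y z x' y' z' x0 y0 z0 H M s t :: real
  assumes rel: "z = s * x + t * y" "z' = s * x' + t * y'" and st: "\<bar>s\<bar> = 1" "\<bar>t\<bar> = 1"
    and nn: "0 \<le> x" "0 \<le> y" "0 \<le> z" "0 \<le> x'" "0 \<le> y'" "0 \<le> z'" "0 \<le> x0" "0 \<le> y0" "0 \<le> z0" "0 \<le> H"
    and b: "x \<le> H * x0" "x' \<le> H * x0" "y \<le> H * y0" "y' \<le> H * y0" "z \<le> H * z0" "z' \<le> H * z0"
    and M: "M \<le> x0 \<or> M \<le> y0 \<or> M \<le> z0"
  shows "\<bar>x * y' - x' * y\<bar> * M \<le> H^2 * x0 * y0 * z0"
proof -
  let ?Q = "\<bar>x * y' - x' * y\<bar>"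
  have "z * y' - z' * y = s * (x * y' - x' * y)" by (simp add: rel algebra_simps)
  hence Q1: "?Q = \<bar>z * y' - z' * y\<bar>" using st by (simp add: abs_mult)
  have "x * z' - x' * z = t * (x * y' - x' * y)" by (simp add: rel algebra_simps)
  hence Q2: "?Q = \<bar>x * z' - x' * z\<bar>" using st by (simp add: abs_mult)
  have B: "?Q \<le> (H * x0) * (H * y0)" using nn b by (intro abs_cross_diff_le) auto
  have B1: "?Q \<le> (H * z0) * (H * y0)" unfolding Q1 using nn b by (intro abs_cross_diff_le) auto
  have B2: "?Q \<le> (H * x0) * (H * z0)" unfolding Q2 using nn b by (intro abs_cross_diff_le) auto
  from M consider "M \<le> x0" | "M \<le> y0" | "M \<le> z0" by blast
  thus ?thesis
  proof cases
    case 1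
    have "?Q * M \<le> ?Q * x0" by (rule mult_left_mono[OF 1]) simp
    also have "\<dots> \<le> (H * z0) * (H * y0) * x0" by (rule mult_right_mono[OF B1 nn(7)])
    finally show ?thesis by (simp add: power2_eq_square mult_ac)
  next
    case 2
    have "?Q * M \<le> ?Q * y0" by (rule mult_left_mono[OF 2]) simp
    also have "\<dots> \<le> (H * x0) * (H * z0) * y0" by (rule mult_right_mono[OF B2 nn(8)])
    finally show ?thesis by (simp add: power2_eq_square mult_ac)
  next
    case 3
    have "?Q * M \<le> ?Q * z0" by (rule mult_left_mono[OF 3]) simp
    also have "\<dots> \<le> (H * x0) * (H * y0) * z0" by (rule mult_right_mono[OF B nn(9)])
    finally show ?thesis by (simp add: power2_eq_square mult_ac)
  qed
qed

text \<open>
  The solutions fall into few lattices of determinant about \<open>C\<close>; in one lattice the slopes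
  \<open>u/v\<close> are separated because determinants are multiples of \<open>C\<close>, while the relation between
  the three terms confines them to a short interval.
\<close>

lemma lattice_count:
  fixes S :: "(nat \<times> nat) set" and A B C k :: nat and \<sigma> \<tau> :: int and w :: "nat \<Rightarrow> nat \<Rightarrow> nat"
    and H x0 y0 z0 u0 v0 M :: real
  assumes fin: "finite S" and k: "k \<in> {1,2,3}" and H: "H \<ge> 1"
    and pos: "A > 0" "B > 0" "C > 0" "x0 > 0" "y0 > 0" "z0 > 0" "u0 > 0" "v0 > 0" "M > 0"
    and st: "\<bar>\<sigma>\<bar> = 1" "\<bar>\<tau>\<bar> = 1" and coA: "coprime A C"
    and S: "\<And>u v. (u, v) \<in> S \<Longrightarrow> 0 < u \<and> 0 < v \<and> coprime u v \<and> coprime u C \<and> coprime v C"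
    and eq: "\<And>u v. (u, v) \<in> S \<Longrightarrow> int (C * w u v) = \<sigma> * int (A * u^k) + \<tau> * int (B * v^k)"
    and sx: "\<And>u v. (u, v) \<in> S \<Longrightarrow> real (A * u^k) \<le> H * x0 \<and> x0 \<le> H * real (A * u^k)"
    and sy: "\<And>u v. (u, v) \<in> S \<Longrightarrow> real (B * v^k) \<le> H * y0 \<and> y0 \<le> H * real (B * v^k)"
    and sz: "\<And>u v. (u, v) \<in> S \<Longrightarrow> real (C * w u v) \<le> H * z0"
    and su: "\<And>u v. (u, v) \<in> S \<Longrightarrow> real u \<le> H * u0"
    and sv: "\<And>u v. (u, v) \<in> S \<Longrightarrow> real v \<le> H * v0 \<and> v0 \<le> H * real v"
    and M: "M \<le> x0 \<or> M \<le> y0 \<or> M \<le> z0"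
  shows "real (card S) \<le> real (card {d. d dvd C})^2 * (1 + 18 * H^8 * (u0 * v0 * z0 / (real C * M)))"
proof -
  define S' where "S' = (\<lambda>(u, v). (int u, int v)) ` S"
  have k0: "k > 0" using k by auto
  have "\<exists>f. f ` S' \<subseteq> {d. d > 0 \<and> d dvd int C} \<times> {d. d > 0 \<and> d dvd int C} \<and>
    (\<forall>u v u' v'. (u, v) \<in> S' \<longrightarrow> (u', v') \<in> S' \<longrightarrow> f (u, v) = f (u', v') \<longrightarrow> int C dvd 18 * (u * v' - u' * v))"
  proof (rule root_classes[OF k])
    show "int C > 0" using pos by simp
    show "coprime u (int C) \<and> coprime v (int C)" if "(u, v) \<in> S'" for u v
      using that S by (auto simp: S'_def)
    show "int C dvd (u * v')^k - (u' * v)^k" if uv: "(u, v) \<in> S'" "(u', v') \<in> S'" for u v u' v'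
    proof -
      obtain a b a' b' where ab: "(a, b) \<in> S" "(a', b') \<in> S" "u = int a" "v = int b" "u' = int a'" "v' = int b'"
        using uv by (auto simp: S'_def)
      \<comment> \<open>The combination eliminates the terms with \<open>B\<close>; what remains
        carries the factor \<open>\<sigma> * A\<close>, a unit modulo \<open>C\<close>.\<close>
      have "int C dvd v' ^ k * int (C * w a b) - v ^ k * int (C * w a' b')"
        by (rule dvd_diff[OF dvd_mult dvd_mult]) simp_all
      also have "\<dots> = (\<sigma> * int A) * ((u * v')^k - (u' * v)^k)"
        unfolding eq[OF ab(1)] eq[OF ab(2)] ab by (simp add: power_mult_distrib algebra_simps)
      finally show ?thesis
      proof (rule dvd_coprime_cancel)
        have "coprime \<sigma> (int C)" using st(1) by (intro is_unit_left_imp_coprime) simp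
        thus "coprime (\<sigma> * int A) (int C)" using coA by simp
      qed simp
    qed
  qed
  then obtain f where f: "f ` S' \<subseteq> {d. d > 0 \<and> d dvd int C} \<times> {d. d > 0 \<and> d dvd int C}"
    "\<And>u v u' v'. (u, v) \<in> S' \<Longrightarrow> (u', v') \<in> S' \<Longrightarrow> f (u, v) = f (u', v') \<Longrightarrow> int C dvd 18 * (u * v' - u' * v)"
    by blast
  define g where "g = (\<lambda>(u, v). f (int u, int v))"
  define R where "R = {d. d > 0 \<and> d dvd int C} \<times> {d. d > 0 \<and> d dvd int C}"
  define slope where "slope = (\<lambda>(u, v). real u / real v)"
  \<comment> \<open>Minimal distance of two slopes with one label: their determinant is nonzero and
    at least C/18 in absolute value, and the denominators are at most \<open>H * v0\<close>.\<close>
  define d where "d = real C / (18 * H^2 * v0^2)"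
  \<comment> \<open>Length of the interval: up to powers of \<open>H\<close>, the slopes near u0/v0
    vary by the relative amount z0/M.\<close>
  define L where "L = H^6 * z0 * u0 / (v0 * M)"
  have d0: "d > 0" and L0: "L \<ge> 0" using pos H by (auto simp: d_def L_def)
  have det: "\<bar>slope (u, v) - slope (u', v')\<bar> = \<bar>real u * real v' - real u' * real v\<bar> / (real v * real v')"
    if "(u, v) \<in> S" "(u', v') \<in> S" for u v u' v'
  proof -
    have "slope (u, v) - slope (u', v') = (real u * real v' - real u' * real v) / (real v * real v')"
      using S[OF that(1)] S[OF that(2)] by (simp add: slope_def field_simps)
    thus ?thesis by (simp add: abs_divide)
  qed
  have inj: "inj_on slope S"
  proof (rule inj_onI)
    fix s s' assume s: "s \<in> S" "s' \<in> S" "slope s = slope s'"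
    obtain u v u' v' where uv: "s = (u, v)" "s' = (u', v')" by force
    have "real u * real v' = real u' * real v"
      using s S[of u v] S[of u' v'] by (auto simp: slope_def uv field_simps)
    hence "u * v' = u' * v" by (metis of_nat_eq_iff of_nat_mult)
    thus "s = s'"
      using S[of u v] S[of u' v'] s uv coprime_crossproduct_nat[of u v u' v'] by (auto simp: mult.commute)
  qed
  have far: "\<bar>slope (u, v) - slope (u', v')\<bar> \<le> L" if s: "(u, v) \<in> S" "(u', v') \<in> S" for u v u' v'
  proof -
    let ?D = "\<bar>real u * real v' - real u' * real v\<bar>"
    define x y x' y' where xy: "x = real (A * u^k)" "y = real (B * v^k)" "x' = real (A * u'^k)" "y' = real (B * v'^k)"
    have uv: "0 < real u" "0 < real v" "0 < real u'" "0 < real v'" using S[OF s(1)] S[OF s(2)] by auto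
    have rel: "real (C * w u v) = of_int \<sigma> * x + of_int \<tau> * y" "real (C * w u' v') = of_int \<sigma> * x' + of_int \<tau> * y'"
      using arg_cong[OF eq[OF s(1)], of real_of_int] arg_cong[OF eq[OF s(2)], of real_of_int] by (simp_all add: xy)
    have st': "\<bar>real_of_int \<sigma>\<bar> = 1" "\<bar>real_of_int \<tau>\<bar> = 1" using st by (metis of_int_1 of_int_abs)+
    have Q: "\<bar>x * y' - x' * y\<bar> * M \<le> H^2 * x0 * y0 * z0"
      by (rule cross_determinant_bound[OF rel st'])
        (use pos H M sx[OF s(1)] sx[OF s(2)] sy[OF s(1)] sy[OF s(2)] sz[OF s(1)] sz[OF s(2)] in \<open>auto simp: xy\<close>)
    \<comment> \<open>Multiplied by \<open>A * B\<close>, the difference of the k-th powers of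
      \<open>u * v'\<close> and \<open>u' * v\<close> is the cross determinant of the terms of the
      equation, which \<open>Q\<close> bounds.\<close>
    have "?D * (real u * real v') ^ (k - 1) \<le> \<bar>(real u * real v')^k - (real u' * real v)^k\<bar>"
      using uv k0 by (intro abs_power_diff_ge) auto
    hence "real A * real B * (?D * (real u * real v') ^ (k - 1)) * (real u * real v')
        \<le> real A * real B * \<bar>(real u * real v')^k - (real u' * real v)^k\<bar> * (real u * real v')"
      using uv pos by (intro mult_right_mono mult_left_mono) auto
    also have "real A * real B * \<bar>(real u * real v')^k - (real u' * real v)^k\<bar>
        = \<bar>real A * real B * ((real u * real v')^k - (real u' * real v)^k)\<bar>"
      by (simp add: abs_mult)
    also have "real A * real B * ((real u * real v')^k - (real u' * real v)^k) = x * y' - x' * y"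
      by (simp add: xy power_mult_distrib algebra_simps)
    also have "real A * real B * (?D * (real u * real v') ^ (k - 1)) * (real u * real v')
        = ?D * (real A * real B * (real u * real v') ^ k)"
      by (subst power_minus_mult[OF k0, of "real u * real v'", symmetric]) (simp only: mult_ac)
    also have "real A * real B * (real u * real v') ^ k = x * y'"
      by (simp add: xy power_mult_distrib algebra_simps)
    finally have D1: "?D * (x * y') \<le> \<bar>x * y' - x' * y\<bar> * (real u * real v')" .
    have xy0: "x0 * y0 \<le> H^2 * (x * y')"
      using mult_mono[of x0 "H * x" y0 "H * y'"] sx[OF s(1)] sy[OF s(2)] pos H
      by (auto simp: xy power2_eq_square mult_ac)
    have "(?D * M) * (x0 * y0) \<le> (?D * M) * (H^2 * (x * y'))"
      using xy0 pos by (intro mult_left_mono) auto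
    also have "\<dots> = H^2 * M * (?D * (x * y'))" by (simp add: mult_ac)
    also have "\<dots> \<le> H^2 * M * (\<bar>x * y' - x' * y\<bar> * (real u * real v'))"
      using D1 pos by (intro mult_left_mono) auto
    also have "\<dots> = (H^2 * (real u * real v')) * (\<bar>x * y' - x' * y\<bar> * M)" by (simp add: mult_ac)
    also have "\<dots> \<le> (H^2 * (real u * real v')) * (H^2 * x0 * y0 * z0)"
      using Q uv by (intro mult_left_mono) auto
    also have "\<dots> = (H^4 * z0 * (real u * real v')) * (x0 * y0)" by (simp add: power4_eq_xxxx power2_eq_square mult_ac)
    finally have D2: "?D * M \<le> H^4 * z0 * (real u * real v')" using pos by simp
    have uv2: "real u * v0 \<le> H * u0 * (H * real v)"
      using su[OF s(1)] sv[OF s(1)] pos uv H by (intro mult_mono) auto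
    have "?D * M * v0 \<le> H^4 * z0 * (real u * real v') * v0" using D2 pos by (intro mult_right_mono) auto
    also have "\<dots> = (H^4 * z0 * real v') * (real u * v0)" by (simp add: mult_ac)
    also have "\<dots> \<le> (H^4 * z0 * real v') * (H * u0 * (H * real v))" using uv2 pos H by (intro mult_left_mono) auto
    also have "\<dots> = H^6 * z0 * u0 * (real v * real v')"
      by (simp add: power_numeral_reduce mult_ac)
    finally have "?D / (real v * real v') \<le> L"
      using uv pos by (simp add: L_def field_simps)
    thus ?thesis using det[OF s] by simp
  qed
  have sep: "d \<le> \<bar>slope (u, v) - slope (u', v')\<bar>"
    if s: "(u, v) \<in> S" "(u', v') \<in> S" and same: "g (u, v) = g (u', v')" and ne: "slope (u, v) \<noteq> slope (u', v')" for u v u' v'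
  proof -
    have uv: "0 < real u" "0 < real v" "0 < real u'" "0 < real v'" using S[OF s(1)] S[OF s(2)] by auto
    let ?D = "int u * int v' - int u' * int v"
    have "(int u, int v) \<in> S'" "(int u', int v') \<in> S'" using s by (force simp: S'_def)+
    hence "int C dvd 18 * ?D" using same by (intro f(2)) (auto simp: g_def)
    moreover have "?D \<noteq> 0"
    proof
      assume "?D = 0"
      hence "real u * real v' = real u' * real v" by (simp flip: of_nat_mult)
      thus False using ne uv by (simp add: slope_def field_simps)
    qed
    ultimately have "int C \<le> \<bar>18 * ?D\<bar>" using dvd_imp_le_int[of "18 * ?D" "int C"] by simp
    hence "real_of_int (int C) \<le> real_of_int \<bar>18 * ?D\<bar>" by (simp only: of_int_le_iff)
    hence D: "real C \<le> 18 * \<bar>real u * real v' - real u' * real v\<bar>" by simp argo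
    have "real v * real v' \<le> (H * v0) * (H * v0)"
      using sv[OF s(1)] sv[OF s(2)] uv H pos by (intro mult_mono) auto
    hence V: "real v * real v' \<le> H^2 * v0^2" by (simp add: power2_eq_square mult_ac)
    have "d = real C / 18 / (H^2 * v0^2)" by (simp add: d_def)
    also have "\<dots> \<le> real C / 18 / (real v * real v')"
      using V uv pos H by (intro divide_left_mono mult_pos_pos) auto
    also have "\<dots> \<le> \<bar>real u * real v' - real u' * real v\<bar> / (real v * real v')"
      using D uv by (intro divide_right_mono) auto
    finally show ?thesis using det[OF s] by simp
  qed
  have fib: "real (card {s \<in> S. g s = c}) \<le> 1 + L / d" for c
  proof -
    let ?T = "{s \<in> S. g s = c}"
    have "card ?T = card (slope ` ?T)"
      by (rule card_image[symmetric], rule inj_on_subset[OF inj]) auto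
    also have "real \<dots> \<le> 1 + L / d"
    proof (rule card_spaced_le[OF _ d0 L0])
      show "finite (slope ` ?T)" using fin by auto
      show "d \<le> \<bar>x - y\<bar>" if "x \<in> slope ` ?T" "y \<in> slope ` ?T" "x \<noteq> y" for x y
        using that sep by fastforce
      show "\<bar>x - y\<bar> \<le> L" if "x \<in> slope ` ?T" "y \<in> slope ` ?T" for x y
        using that far by fastforce
    qed
    finally show ?thesis .
  qed
  have "real (card S) \<le> real (card R) * (1 + L / d)"
  proof (rule card_le_fibres[OF fin _ _ fib])
    show "finite R" using card_int_divisors(1)[OF pos(3)] by (simp add: R_def)
    show "g ` S \<subseteq> R" using f(1) by (force simp: g_def R_def S'_def)
  qed
  also have "card R = (card {d. d dvd C})^2"
    by (simp add: R_def card_cartesian_product card_int_divisors(2)[OF pos(3)] power2_eq_square)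
  also have "L / d = 18 * H^8 * (u0 * v0 * z0 / (real C * M))"
    using pos H by (simp add: L_def d_def field_simps power_numeral_reduce)
  finally show ?thesis by simp
qed

section \<open>Coincidences between sums of powers\<close>

text \<open>Strict convexity of the l-th power, written without subtraction: (x + d)^l - x^l
  increases with x. Hence a given value of this difference and a given d determine x.\<close>

lemma power_shift_strict_mono:
  fixes x y d :: nat
  assumes "x < y" "d > 0" "l \<ge> 2"
  shows "(x + d) ^ l + y ^ l < (y + d) ^ l + x ^ l"
  using assms(3)
proof (induction l rule: dec_induct)
  case base
  have "x * d < y * d" using assms by simp
  thus ?case by (simp only: power2_sum)
next
  case (step l)
  define a b a' b' where "a = int (x + d)" "b = int x" "a' = int (y + d)" "b' = int y"
  note ab = this
  have IH: "a ^ l - b ^ l < a' ^ l - b' ^ l"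
  proof -
    have "int ((x + d) ^ l + y ^ l) < int ((y + d) ^ l + x ^ l)"
      using step.IH by (simp only: of_nat_less_iff)
    thus ?thesis by (simp add: ab)
  qed
  have nn: "0 \<le> a ^ l - b ^ l" unfolding ab by (simp add: power_mono)
  have "a * (a ^ l - b ^ l) + int d * b ^ l < a' * (a' ^ l - b' ^ l) + int d * b' ^ l"
  proof (rule add_less_le_mono)
    show "a * (a ^ l - b ^ l) < a' * (a' ^ l - b' ^ l)"
      using IH nn assms by (intro mult_strict_mono) (auto simp: ab)
    show "int d * b ^ l \<le> int d * b' ^ l" using assms by (intro mult_left_mono power_mono) (auto simp: ab)
  qed
  also have "a * (a ^ l - b ^ l) + int d * b ^ l = a ^ Suc l - b ^ Suc l" by (simp add: ab algebra_simps)
  also have "a' * (a' ^ l - b' ^ l) + int d * b' ^ l = a' ^ Suc l - b' ^ Suc l" by (simp add: ab algebra_simps)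
  finally have "int ((x + d) ^ Suc l + y ^ Suc l) < int ((y + d) ^ Suc l + x ^ Suc l)"
    unfolding ab by (simp add: algebra_simps)
  thus ?case by (simp only: of_nat_less_iff)
qed

text \<open>The difference v' - v divides \<open>m\<close>, and by strict convexity it determines
  the pair.\<close>

lemma card_power_diff_le:
  fixes V :: "nat set"
  assumes "finite V" "l \<ge> 2" "m > 0"
  shows "card {(v, v') \<in> V \<times> V. v' ^ l = v ^ l + m} \<le> card {d. d dvd m}"
proof (rule card_inj_on_le[of "\<lambda>(v, v'). v' - v"])
  have lt: "v < v'" if "v' ^ l = v ^ l + m" for v v' :: nat
    using that assms(3) by (metis less_add_same_cancel1 power_less_imp_less_base zero_le)
  show "inj_on (\<lambda>(v, v'). v' - v) {(v, v') \<in> V \<times> V. v' ^ l = v ^ l + m}"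
  proof (rule inj_onI, clarify)
    fix v v' w w' assume v: "v' ^ l = v ^ l + m" and w: "w' ^ l = w ^ l + m" and eq: "v' - v = w' - w"
    define d where "d = v' - v"
    have d: "v' = v + d" "w' = w + d" "d > 0" using lt[OF v] lt[OF w] eq by (auto simp: d_def)
    have "v = w"
      using power_shift_strict_mono[of v w d l] power_shift_strict_mono[of w v d l] d v w assms(2)
      by (cases v w rule: linorder_cases) auto
    thus "v = w \<and> v' = w'" using d by simp
  qed
  show "(\<lambda>(v, v'). v' - v) ` {(v, v') \<in> V \<times> V. v' ^ l = v ^ l + m} \<subseteq> {d. d dvd m}"
  proof clarify
    fix v v' assume v: "v' ^ l = v ^ l + m"
    have "int v' - int v dvd int v' ^ l - int v ^ l" 
    proof -
      obtain n where "l = Suc n" using assms(2) by (cases l) auto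
      thus ?thesis by (simp only: diff_power_eq_sum dvd_triv_left)
    qed
    also have "int v' ^ l - int v ^ l = int m" using arg_cong[OF v, of int] by simp
    also have "int v' - int v = int (v' - v)" using lt[OF v] by simp
    finally show "v' - v dvd m" by simp
  qed
qed (use assms in auto)

text \<open>Cauchy-Schwarz for the sizes of the fibres of \<open>g\<close>.\<close>

lemma card_square_le_coincidences:
  assumes "finite S" "finite \<Gamma>" "g ` S \<subseteq> \<Gamma>"
  shows "real (card S)^2 \<le> real (card \<Gamma>) * real (card {(s, s') \<in> S \<times> S. g s = g s'})"
proof -
  let ?F = "\<lambda>c. {s \<in> S. g s = c}"
  have "card S = card (\<Union>c\<in>\<Gamma>. ?F c)" using assms(3) by (intro arg_cong[of _ _ card]) auto
  also have "\<dots> = (\<Sum>c\<in>\<Gamma>. card (?F c))" using assms by (intro card_UN_disjoint) auto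
  finally have 1: "real (card S) = (\<Sum>c\<in>\<Gamma>. real (card (?F c)))" by simp
  have "card {(s, s') \<in> S \<times> S. g s = g s'} = card (\<Union>c\<in>\<Gamma>. ?F c \<times> ?F c)"
    using assms(3) by (intro arg_cong[of _ _ card]) auto
  also have "\<dots> = (\<Sum>c\<in>\<Gamma>. card (?F c \<times> ?F c))" using assms by (intro card_UN_disjoint) auto
  finally have 2: "real (card {(s, s') \<in> S \<times> S. g s = g s'}) = (\<Sum>c\<in>\<Gamma>. (real (card (?F c)))\<^sup>2)"
    by (simp add: power2_eq_square card_cartesian_product del: Collect_case_prod)
  show ?thesis
    unfolding 1 2 using sum_squared_le_sum_of_squares[of "\<lambda>c. real (card (?F c))" \<Gamma>]
    by (simp add: mult.commute)
qed

text \<open>Coincidences of \<open>z\<close> are counted. If u = u', then v = v', which leaves at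
  most |U||V| of them (\<open>E0\<close>). If u and u' differ, they prescribe a nonzero difference
  of two l-th powers up to sign, with at most 2D solutions (\<open>E1\<close>). This costs 2D|U|^2,
  which the assumption on the cardinalities turns into 2D|U||V|.\<close>

lemma energy_count:
  fixes S :: "(nat \<times> nat) set" and U V \<Gamma> :: "nat set" and A B k l N :: nat and \<sigma> \<tau> :: int
    and z :: "nat \<Rightarrow> nat \<Rightarrow> nat" and D :: real
  assumes fin: "finite U" "finite V" "finite \<Gamma>" and sub: "S \<subseteq> U \<times> V" and kl: "k \<ge> 1" "l \<ge> 2"
    and pos: "A > 0" "B > 0" and st: "\<bar>\<sigma>\<bar> = 1" "\<bar>\<tau>\<bar> = 1"
    and eq: "\<And>u v. (u, v) \<in> S \<Longrightarrow> z u v \<in> \<Gamma> \<and> int (z u v) = \<sigma> * int (A * u^k) + \<tau> * int (B * v^l)"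
    and N: "\<And>u v. (u, v) \<in> S \<Longrightarrow> A * u^k \<le> N"
    and D: "D \<ge> 0" "\<And>m. 0 < m \<Longrightarrow> m \<le> N \<Longrightarrow> real (card {d. d dvd m}) \<le> D"
    and UV: "card U \<le> card V"
  shows "real (card S)^2 \<le> real (card \<Gamma>) * (real (card U) * real (card V) * (1 + 2 * D))"
proof -
  have finS: "finite S" using sub fin by (meson finite_SigmaI finite_subset)
  let ?E = "{(s, s') \<in> S \<times> S. case_prod z s = case_prod z s'}"
  define E0 where "E0 = {e \<in> ?E. fst (fst e) = fst (snd e)}"
  define E1 where "E1 = {e \<in> ?E. fst (fst e) \<noteq> fst (snd e)}"
  have rel: "\<bar>int (A * u^k) - int (A * u'^k)\<bar> = \<bar>int (B * v'^l) - int (B * v^l)\<bar>"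
    if "((u, v), (u', v')) \<in> ?E" for u v u' v'
  proof -
    have "\<sigma> * (int (A * u^k) - int (A * u'^k)) = \<tau> * (int (B * v'^l) - int (B * v^l))"
      using that eq[of u v] eq[of u' v'] by (auto simp: algebra_simps)
    from arg_cong[OF this, of abs] show ?thesis using st by (simp add: abs_mult)
  qed
  have finE: "finite ?E" using finS by (rule_tac finite_subset[of _ "S \<times> S"]) auto
  hence fin01: "finite E0" "finite E1" by (auto simp: E0_def E1_def)
  have c0: "card E0 \<le> card (U \<times> V)"
  proof (rule card_inj_on_le[of fst])
    have same: "v = v'" if "((u, v), (u, v')) \<in> ?E" for u v v'
      using rel[OF that] pos kl by (auto simp: power_eq_iff_eq_base)
    show "inj_on fst E0"
    proof (rule inj_onI)
      fix e e' assume e: "e \<in> E0" "e' \<in> E0" "fst e = fst e'"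
      obtain u v u' v' where 1: "e = ((u, v), (u', v'))" by (metis surj_pair)
      obtain w x w' x' where 2: "e' = ((w, x), (w', x'))" by (metis surj_pair)
      have E: "e \<in> ?E" "e' \<in> ?E" using e(1,2) unfolding E0_def by blast+
      have "u' = u" "w' = w" using e(1,2) unfolding E0_def 1 2 by simp_all
      hence "v = v'" "x = x'" using same[of u v v'] same[of w x x'] E unfolding 1 2 by blast+
      thus "e = e'" using e(3) \<open>u' = u\<close> \<open>w' = w\<close> by (simp add: 1 2)
    qed
    show "fst ` E0 \<subseteq> U \<times> V" using sub by (auto simp: E0_def)
  qed (use fin in auto)
  have fib: "real (card {e \<in> E1. (fst (fst e), fst (snd e)) = c}) \<le> 2 * D" if "c \<in> U \<times> U" for c
  proof -
    obtain u u' where c: "c = (u, u')" by force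
    let ?Q = "{e \<in> E1. (fst (fst e), fst (snd e)) = c}"
    show ?thesis
    proof (cases "?Q = {}")
      case True
      show ?thesis using D(1) unfolding True by simp
    next
      case False
      then obtain v1 v1' where v1: "((u, v1), (u', v1')) \<in> ?E" and ne: "u \<noteq> u'"
        by (auto simp: E1_def c)
      define n where "n = \<bar>int (A * u^k) - int (A * u'^k)\<bar>"
      define m where "m = nat \<bar>int (v1'^l) - int (v1^l)\<bar>"
      have "u ^ k \<noteq> u' ^ k" using ne kl by (simp add: power_eq_iff_eq_base)
      hence "int (A * u ^ k) \<noteq> int (A * u' ^ k)" using pos by (simp only: of_nat_eq_iff mult_cancel1) simp
      hence n0: "n > 0" unfolding n_def by linarith
      have red: "n = int B * \<bar>int (v'^l) - int (v^l)\<bar>" if "((u, v), (u', v')) \<in> ?E" for v v'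
        using rel[OF that] unfolding n_def by (simp add: abs_mult flip: right_diff_distrib)
      have nm: "n = int B * int m" using red[OF v1] by (simp add: m_def)
      have m0: "m > 0" using n0 nm by (cases "m = 0") auto
      have "A * u^k \<le> N" "A * u'^k \<le> N" using N[of u v1] N[of u' v1'] v1 by auto
      hence "n \<le> int N" unfolding n_def by linarith
      moreover have "int m \<le> n" using nm pos by (simp add: mult_le_cancel_right1)
      ultimately have mN: "m \<le> N" by simp
      let ?T = "{(v, v') \<in> V \<times> V. v' ^ l = v ^ l + m}"
      have finT: "finite ?T" by (rule finite_subset[of _ "V \<times> V"]) (use fin in auto)
      \<comment> \<open>\<open>rel\<close> fixes the difference of the l-th powers only up to sign;
        the swapped copy of the set accounts for the other sign.\<close>
      have "card ?Q \<le> card (?T \<union> prod.swap ` ?T)"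
      proof (rule card_inj_on_le[of "\<lambda>e. (snd (fst e), snd (snd e))"])
        show "inj_on (\<lambda>e. (snd (fst e), snd (snd e))) ?Q" by (auto simp: inj_on_def c)
        show "(\<lambda>e. (snd (fst e), snd (snd e))) ` ?Q \<subseteq> ?T \<union> prod.swap ` ?T"
        proof
          fix y assume "y \<in> (\<lambda>e. (snd (fst e), snd (snd e))) ` ?Q"
          then obtain v v' where y: "y = (v, v')" and E: "((u, v), (u', v')) \<in> ?E"
            by (auto simp: E1_def c)
          have V: "v \<in> V" "v' \<in> V" using E sub by auto
          have "int m = \<bar>int (v'^l) - int (v^l)\<bar>" using red[OF E] nm pos by simp
          hence "int (v'^l) = int (v^l) + int m \<or> int (v^l) = int (v'^l) + int m" by linarith
          hence "v'^l = v^l + m \<or> v^l = v'^l + m" by (metis of_nat_add of_nat_eq_iff)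
          thus "y \<in> ?T \<union> prod.swap ` ?T" using V by (force simp: y image_iff)
        qed
      qed (use finT in auto)
      also have "\<dots> \<le> card ?T + card ?T"
        using card_Un_le[of ?T "prod.swap ` ?T"] card_image_le[OF finT, of prod.swap] by linarith
      also have "\<dots> \<le> 2 * card {d. d dvd m}"
        using card_power_diff_le[OF fin(2) kl(2) m0] by simp
      finally have "real (card ?Q) \<le> 2 * real (card {d. d dvd m})" by linarith
      also have "\<dots> \<le> 2 * D" using D(2)[OF m0 mN] by simp
      finally show ?thesis .
    qed
  qed
  have "real (card E1) \<le> real (card (U \<times> U)) * (2 * D)"
    by (rule card_le_fibres[OF fin01(2) _ _ fib]) (use fin sub in \<open>auto simp: E1_def\<close>)
  also have "\<dots> \<le> real (card U) * real (card V) * (2 * D)"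
    using UV D(1) by (simp add: mult_mono card_cartesian_product mult_right_mono mult_left_mono)
  finally have c1: "real (card E1) \<le> real (card U) * real (card V) * (2 * D)" .
  have "?E = E0 \<union> E1" by (auto simp: E0_def E1_def)
  hence "card ?E \<le> card E0 + card E1" by (metis card_Un_le)
  hence "real (card ?E) \<le> real (card E0) + real (card E1)" by linarith
  also have "real (card E0) \<le> real (card U) * real (card V)"
    using c0 by (simp add: card_cartesian_product flip: of_nat_mult)
  also note c1
  finally have E: "real (card ?E) \<le> real (card U) * real (card V) * (1 + 2 * D)"
    by (simp add: algebra_simps)
  have "real (card S)^2 \<le> real (card \<Gamma>) * real (card ?E)"
    using eq by (intro card_square_le_coincidences finS fin(3)) auto
  also have "\<dots> \<le> real (card \<Gamma>) * (real (card U) * real (card V) * (1 + 2 * D))"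
    using E by (intro mult_left_mono) auto
  finally show ?thesis .
qed

section \<open>Decomposition by multiplicity\<close>

text \<open>Class \<open>5\<close> collects all primes of multiplicity at least \<open>5\<close>.\<close>

definition expclass :: "nat \<Rightarrow> nat \<Rightarrow> nat set" where
  "expclass n i = {p \<in> prime_factors n. min 5 (multiplicity p n) = i}"

definition part :: "nat \<Rightarrow> nat \<Rightarrow> nat" where
  "part n i = (\<Prod>p\<in>expclass n i. p ^ multiplicity p n)"

definition radpart :: "nat \<Rightarrow> nat \<Rightarrow> nat" where
  "radpart n i = (\<Prod>p\<in>expclass n i. p)"

definition parts :: "nat \<Rightarrow> nat set \<Rightarrow> nat" where
  "parts n J = (\<Prod>i\<in>J. part n i)"

text \<open>The sets of classes whose parts multiply to a visible perfect k-th power. Class 5 mixes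
  different multiplicities and therefore occurs only for k = 1.\<close>

definition admissible :: "nat \<Rightarrow> nat set \<Rightarrow> bool" where
  "admissible k I \<longleftrightarrow> I \<subseteq> {1..5} \<and> (k = 1 \<or> (\<forall>i\<in>I. i \<le> 4 \<and> k dvd i))"

definition rootpart :: "nat \<Rightarrow> nat \<Rightarrow> nat set \<Rightarrow> nat" where
  "rootpart k n I = (if k = 1 then parts n I else \<Prod>i\<in>I. radpart n i ^ (i div k))"

text \<open>A dyadic box described by a reference number \<open>n\<close> inside it: the scales of
  the box are the parts of \<open>n\<close> itself, and so satisfy exactly the relations that hold
  for the parts of an integer.\<close>

definition near :: "nat \<Rightarrow> nat \<Rightarrow> bool" where
  "near m n \<longleftrightarrow> m > 0 \<and> (\<forall>i\<in>{1..5}. part m i \<le> 2 * part n i \<and> part n i \<le> 2 * part m i \<and>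
     radpart m i \<le> 2 * radpart n i)"

lemma finite_expclass [simp]: "finite (expclass n i)"
  by (simp add: expclass_def)

lemma expclass_prime: "p \<in> expclass n i \<Longrightarrow> prime p"
  by (auto simp: expclass_def)

lemma part_pos [simp]: "part n i > 0"
  unfolding part_def by (intro prod_pos) (auto dest: expclass_prime prime_gt_0_nat)

lemma radpart_pos [simp]: "radpart n i > 0"
  unfolding radpart_def by (intro prod_pos) (auto dest: expclass_prime prime_gt_0_nat)

lemma parts_pos [simp]: "parts n J > 0"
  unfolding parts_def by (intro prod_pos) auto

lemma prod_expclasses:
  "(\<Prod>i\<in>{1..5}. \<Prod>p\<in>expclass n i. f p) = (\<Prod>p\<in>prime_factors n. f p)"
proof -
  have eq: "prime_factors n = (\<Union>i\<in>{1..5}. expclass n i)"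
    by (auto simp: expclass_def prime_factors_multiplicity)
  have "expclass n i \<inter> expclass n j = {}" if "i \<noteq> j" for i j
    using that unfolding expclass_def by blast
  thus ?thesis unfolding eq by (intro prod.UNION_disjoint[symmetric]) auto
qed

lemma parts_all: "n > 0 \<Longrightarrow> parts n {1..5} = n"
  unfolding parts_def part_def prod_expclasses by (simp flip: prime_factorization_nat)

lemma rad_eq_prod_radpart: "rad n = (\<Prod>i\<in>{1..5}. radpart n i)"
  unfolding rad_def radpart_def prod_expclasses ..

lemma part_eq_power: "i \<le> 4 \<Longrightarrow> part n i = radpart n i ^ i"
  unfolding part_def radpart_def prod_power_distrib
  by (intro prod.cong refl) (auto simp: expclass_def min_def split: if_splits)

lemma radpart_power_le_part: "radpart n 5 ^ 5 \<le> part n 5"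
  unfolding part_def radpart_def prod_power_distrib
proof (intro prod_mono conjI)
  fix p assume p: "p \<in> expclass n 5"
  hence "5 \<le> multiplicity p n" by (auto simp: expclass_def min_def split: if_splits)
  thus "p ^ 5 \<le> p ^ multiplicity p n"
    using prime_ge_1_nat[OF expclass_prime[OF p]] by (rule power_increasing)
qed auto

lemma prime_factors_part: "prime_factors (part n i) = expclass n i"
proof -
  have "prime_factors (part n i) = (\<Union>p\<in>expclass n i. prime_factors (p ^ multiplicity p n))"
    unfolding part_def by (subst prime_factors_prod) (auto dest: expclass_prime)
  also have "\<dots> = (\<Union>p\<in>expclass n i. {p})"
    by (intro SUP_cong refl)
      (auto simp: prime_factorization_prime_power expclass_def prime_factors_multiplicity)
  finally show ?thesis by simp
qed

lemma prime_factors_radpart: "prime_factors (radpart n i) = expclass n i"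
proof -
  have "prime_factors (radpart n i) = (\<Union>p\<in>expclass n i. prime_factors p)"
    unfolding radpart_def by (subst prime_factors_prod) (auto dest: expclass_prime)
  also have "\<dots> = (\<Union>p\<in>expclass n i. {p})"
    by (intro SUP_cong refl) (simp add: prime_factorization_prime expclass_prime)
  finally show ?thesis by simp
qed

lemma rootpart_power:
  assumes "admissible k I"
  shows "rootpart k n I ^ k = parts n I"
proof (cases "k = 1")
  case False
  have "rootpart k n I ^ k = (\<Prod>i\<in>I. radpart n i ^ (i div k * k))"
    using False by (simp add: rootpart_def prod_power_distrib power_mult)
  also have "\<dots> = (\<Prod>i\<in>I. part n i)"
    using assms False by (intro prod.cong refl) (auto simp: admissible_def part_eq_power)
  finally show ?thesis by (simp add: parts_def)
qed (simp add: rootpart_def)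

lemma rootpart_pos [simp]: "rootpart k n I > 0"
  by (simp add: rootpart_def prod_pos)

lemma parts_split:
  assumes "n > 0" "I \<subseteq> {1..5}"
  shows "n = parts n ({1..5} - I) * parts n I"
  using parts_all[OF assms(1)] assms(2) prod.subset_diff[of I "{1..5}" "part n"]
  by (simp add: parts_def)

text \<open>There are at most five classes, each off by a factor of at most 2; hence 32 = 2^5, which
  is also the \<open>H\<close> used in the lattice bound.\<close>

lemma parts_le_near:
  assumes "near m n" "J \<subseteq> {1..5}"
  shows "parts m J \<le> 32 * parts n J" "parts n J \<le> 32 * parts m J"
proof -
  have fin: "finite J" using assms(2) finite_subset by blast
  have c: "card J \<le> 5" using card_mono[OF _ assms(2)] by simp
  have b: "(2::nat) ^ card J \<le> 32" using power_increasing[OF c, of "2::nat"] by simp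
  have "parts m J \<le> (\<Prod>i\<in>J. 2 * part n i)" "parts n J \<le> (\<Prod>i\<in>J. 2 * part m i)"
    unfolding parts_def using assms by (auto simp: near_def intro!: prod_mono)
  hence "parts m J \<le> 2 ^ card J * parts n J" "parts n J \<le> 2 ^ card J * parts m J"
    by (simp_all add: parts_def prod.distrib)
  thus "parts m J \<le> 32 * parts n J" "parts n J \<le> 32 * parts m J"
    using b by (meson mult_le_mono1 order_trans)+
qed

lemma near_le:
  assumes "near m n" "n > 0"
  shows "m \<le> 32 * n" "n \<le> 32 * m"
  using parts_le_near[OF assms(1), of "{1..5}"] assms parts_all by (auto simp: near_def)

lemma rootpart_le_near:
  assumes "near m n" "admissible k I" "k > 0"
  shows "rootpart k m I \<le> 32 * rootpart k n I" "rootpart k n I \<le> 32 * rootpart k m I"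
proof -
  have I: "I \<subseteq> {1..5}" using assms(2) by (auto simp: admissible_def)
  have b: "(32::nat) \<le> 32 ^ k" using assms(3) by (simp add: self_le_power)
  have "rootpart k m I ^ k \<le> 32 * rootpart k n I ^ k" "rootpart k n I ^ k \<le> 32 * rootpart k m I ^ k"
    using parts_le_near[OF assms(1) I] by (simp_all add: rootpart_power[OF assms(2)])
  hence "rootpart k m I ^ k \<le> (32 * rootpart k n I) ^ k" "rootpart k n I ^ k \<le> (32 * rootpart k m I) ^ k"
    unfolding power_mult_distrib using b by (meson mult_le_mono1 order_trans)+
  thus "rootpart k m I \<le> 32 * rootpart k n I" "rootpart k n I \<le> 32 * rootpart k m I"
    using assms(3) power_mono_iff[of _ _ k] by blast+
qed

section \<open>Number of values of the parts in a box\<close>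

lemma divisor_count_bound_32:
  fixes e :: real
  assumes e: "e > 0"
  shows "\<exists>M>0. \<forall>Y\<ge>1. \<forall>m::nat. 0 < m \<longrightarrow> real m \<le> 32 * Y \<longrightarrow> real (card {d. d dvd m}) \<le> M * Y powr e"
proof -
  obtain M where M: "M > 0" "\<And>n::nat. n > 0 \<Longrightarrow> real (card {d. d dvd n}) \<le> M * real n powr e"
    using divisor_count_bound[OF e] by auto
  have "real (card {d. d dvd m}) \<le> (M * 32 powr e) * Y powr e"
    if "Y \<ge> 1" "0 < m" "real m \<le> 32 * Y" for Y :: real and m :: nat
  proof -
    have "real (card {d. d dvd m}) \<le> M * real m powr e" using M(2) that by blast
    also have "\<dots> \<le> M * (32 * Y) powr e" using that M(1) e by (intro mult_left_mono powr_mono2) auto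
    also have "\<dots> = (M * 32 powr e) * Y powr e" using that by (simp add: powr_mult)
    finally show ?thesis .
  qed
  thus ?thesis using M(1) by (intro exI[of _ "M * 32 powr e"]) auto
qed

text \<open>The radical of the part is one of at most \<open>2 * radpart n i\<close> numbers. It
  fixes the prime support, after which \<open>card_prime_support_bound\<close> leaves Y^e
  choices.\<close>

lemma card_part_values:
  fixes e :: real
  assumes e: "e > 0"
  shows "\<exists>M\<ge>1. \<forall>n Y i. n > 0 \<longrightarrow> real n \<le> Y \<longrightarrow> i \<in> {1..5} \<longrightarrow>
    finite ((\<lambda>m. part m i) ` {m. near m n}) \<and>
    real (card ((\<lambda>m. part m i) ` {m. near m n})) \<le> M * Y powr e * real (radpart n i)"
proof -
  obtain M where M: "M > 0" "\<And>X P. X > 0 \<Longrightarrow>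
      real (card {m::nat. m > 0 \<and> real m \<le> X \<and> prime_factors m = P}) \<le> M * X powr e"
    using card_prime_support_bound[OF e] by auto
  define M' where "M' = 1 + 2 * M * 2 powr e"
  have "finite ((\<lambda>m. part m i) ` {m. near m n}) \<and>
    real (card ((\<lambda>m. part m i) ` {m. near m n})) \<le> M' * Y powr e * real (radpart n i)"
    if n: "n > 0" and Y: "real n \<le> Y" and i: "i \<in> {1..5}" for n Y i
  proof -
    let ?V = "(\<lambda>m. part m i) ` {m. near m n}"
    let ?Q = "\<lambda>P. {q::nat. q > 0 \<and> real q \<le> 2 * Y \<and> prime_factors q = P}"
    have Y0: "Y \<ge> 1" using n Y by linarith
    have pn: "part n i \<le> n"
    proof -
      have "part n i dvd parts n {1..5}" unfolding parts_def using i by (intro dvd_prodI) auto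
      thus ?thesis using n parts_all[OF n] by (simp add: dvd_imp_le)
    qed
    have fin: "finite (?Q P)" for P
      by (rule finite_subset[of _ "{..nat \<lceil>2 * Y\<rceil>}"]) (auto simp: le_nat_iff, linarith)
    have sub: "?V \<subseteq> (\<Union>r\<in>{1..2 * radpart n i}. ?Q (prime_factors r))"
    proof
      fix q assume "q \<in> ?V"
      then obtain m where m: "near m n" "q = part m i" by auto
      have "part m i \<le> 2 * part n i" "radpart m i \<le> 2 * radpart n i" using m(1) i by (auto simp: near_def)
      moreover from this(1) have "real (part m i) \<le> 2 * Y" using pn Y by linarith
      moreover have "prime_factors (radpart m i) = expclass m i"
        by (rule prime_factors_radpart)
      ultimately show "q \<in> (\<Union>r\<in>{1..2 * radpart n i}. ?Q (prime_factors r))"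
        using m(2) by (auto simp: prime_factors_part Suc_le_eq intro!: bexI[of _ "radpart m i"])
    qed
    have finV: "finite ?V" using sub fin by (meson finite_UN_I finite_atLeastAtMost finite_subset)
    have "card ?V \<le> card (\<Union>r\<in>{1..2 * radpart n i}. ?Q (prime_factors r))"
      using sub fin by (intro card_mono) auto
    also have "\<dots> \<le> (\<Sum>r\<in>{1..2 * radpart n i}. card (?Q (prime_factors r)))"
      by (intro card_UN_le) auto
    finally have "real (card ?V) \<le> (\<Sum>r\<in>{1..2 * radpart n i}. real (card (?Q (prime_factors r))))"
      unfolding of_nat_sum[symmetric] of_nat_le_iff .
    also have "\<dots> \<le> (\<Sum>r\<in>{1..2 * radpart n i}. M * (2 * Y) powr e)"
      using Y0 by (intro sum_mono M(2)) auto
    also have "\<dots> = (2 * M * 2 powr e) * (Y powr e * real (radpart n i))"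
      using Y0 by (simp add: powr_mult)
    also have "\<dots> \<le> M' * (Y powr e * real (radpart n i))"
      unfolding M'_def by (intro mult_right_mono) auto
    finally show ?thesis using finV by (simp add: mult_ac)
  qed
  thus ?thesis using M(1) by (intro exI[of _ M']) (auto simp: M'_def)
qed

lemma card_parts_values:
  fixes e :: real
  assumes e: "e > 0"
  shows "\<exists>M\<ge>1. \<forall>n Y J. n > 0 \<longrightarrow> real n \<le> Y \<longrightarrow> J \<subseteq> {1..5} \<longrightarrow>
    finite ((\<lambda>m. parts m J) ` {m. near m n}) \<and>
    real (card ((\<lambda>m. parts m J) ` {m. near m n})) \<le> M * Y powr e * real (\<Prod>i\<in>J. radpart n i)"
proof -
  obtain M where M: "M \<ge> 1" "\<And>n Y i. n > 0 \<Longrightarrow> real n \<le> Y \<Longrightarrow> i \<in> {1..5} \<Longrightarrow>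
    finite ((\<lambda>m. part m i) ` {m. near m n}) \<and>
    real (card ((\<lambda>m. part m i) ` {m. near m n})) \<le> M * Y powr (e/5) * real (radpart n i)"
    using card_part_values[of "e/5"] e by auto
  have "finite ((\<lambda>m. parts m J) ` {m. near m n}) \<and>
    real (card ((\<lambda>m. parts m J) ` {m. near m n})) \<le> M ^ 5 * Y powr e * real (\<Prod>i\<in>J. radpart n i)"
    if n: "n > 0" and Y: "real n \<le> Y" and J: "J \<subseteq> {1..5}" for n Y J
  proof -
    define V where "V i = (\<lambda>m. part m i) ` {m. near m n}" for i
    have Y0: "Y \<ge> 1" using n Y by linarith
    have finJ: "finite J" using J finite_subset by blast
    have cJ: "card J \<le> 5" using card_mono[OF _ J] by simp
    have V: "finite (V i)" "real (card (V i)) \<le> M * Y powr (e/5) * real (radpart n i)" if "i \<in> J" for i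
      using M(2)[OF n Y, of i] that J unfolding V_def by blast+
    have fin: "finite (PiE J V)" using finJ V(1) by (intro finite_PiE) auto
    have sub: "(\<lambda>m. parts m J) ` {m. near m n} \<subseteq> (\<lambda>f. \<Prod>i\<in>J. f i) ` PiE J V"
    proof clarify
      fix m assume "near m n"
      hence "restrict (part m) J \<in> PiE J V" by (auto simp: V_def)
      moreover have "parts m J = (\<Prod>i\<in>J. restrict (part m) J i)" by (simp add: parts_def)
      ultimately show "parts m J \<in> (\<lambda>f. \<Prod>i\<in>J. f i) ` PiE J V" by blast
    qed
    have "card ((\<lambda>m. parts m J) ` {m. near m n}) \<le> card (PiE J V)"
      using sub fin by (meson card_image_le card_mono finite_imageI order_trans)
    hence "real (card ((\<lambda>m. parts m J) ` {m. near m n})) \<le> (\<Prod>i\<in>J. real (card (V i)))"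
      using finJ by (simp add: card_PiE flip: of_nat_prod)
    also have "\<dots> \<le> (\<Prod>i\<in>J. (M * Y powr (e/5)) * real (radpart n i))"
      using V(2) by (intro prod_mono) auto
    also have "\<dots> = (M * Y powr (e/5)) ^ card J * real (\<Prod>i\<in>J. radpart n i)"
      by (simp add: prod.distrib)
    also have "\<dots> \<le> (M * Y powr (e/5)) ^ 5 * real (\<Prod>i\<in>J. radpart n i)"
    proof (intro mult_right_mono power_increasing cJ)
      have "1 \<le> Y powr (e/5)" using Y0 e by (simp add: ge_one_powr_ge_zero)
      thus "1 \<le> M * Y powr (e/5)" using M(1) mult_mono[of 1 M 1 "Y powr (e/5)"] by simp
    qed (rule of_nat_0_le_iff)
    also have "(M * Y powr (e/5)) ^ 5 = M ^ 5 * Y powr e"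
      using Y0 powr_realpow[of "Y powr (e/5)" 5] by (simp add: power_mult_distrib powr_powr)
    finally show ?thesis using finite_subset[OF sub finite_imageI[OF fin]] by blast
  qed
  thus ?thesis using M(1) by (intro exI[of _ "M ^ 5"]) auto
qed

section \<open>Counting triples in a box\<close>

text \<open>The signs make the notion closed under permutation: x + y = z solved for any of its
  terms has this form. Thus each number can take each role in the two bounds.\<close>

definition box :: "(nat \<times> nat \<times> nat) set \<Rightarrow> int \<Rightarrow> int \<Rightarrow> nat \<Rightarrow> nat \<Rightarrow> nat \<Rightarrow> bool" where
  "box S \<sigma> \<tau> a b c \<longleftrightarrow> finite S \<and> \<bar>\<sigma>\<bar> = 1 \<and> \<bar>\<tau>\<bar> = 1 \<and> a > 0 \<and> b > 0 \<and> c > 0 \<and>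
     (\<forall>x y z. (x, y, z) \<in> S \<longrightarrow> near x a \<and> near y b \<and> near z c \<and>
        coprime x y \<and> coprime x z \<and> coprime y z \<and> int z = \<sigma> * int x + \<tau> * int y)"

lemma coprime_parts:
  assumes "m > 0" "n > 0" "coprime m n" "I \<subseteq> {1..5}" "J \<subseteq> {1..5}"
  shows "coprime (parts m I) (parts n J)"
proof -
  have "parts m I dvd m" "parts n J dvd n"
    using parts_split[OF assms(1,4)] parts_split[OF assms(2,5)] by (metis dvd_triv_right)+
  thus ?thesis using assms(3) by (meson coprime_divisors)
qed

text \<open>The parts outside \<open>I\<close>, \<open>J\<close>, \<open>K\<close> are fixed first,
  and the product of their radicals counts the ways. For each choice \<open>lattice_count\<close>
  handles the rest, with the roots over \<open>I\<close> and \<open>J\<close> as u and v, and the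
  parts over \<open>K\<close> as the cofactor of the modulus.\<close>

lemma box_lattice_bound:
  fixes e :: real
  assumes e: "e > 0" and k: "k \<in> {1,2,3}"
  shows "\<exists>M>0. \<forall>S \<sigma> \<tau> a b c I J K (Y::nat).
    box S \<sigma> \<tau> a b c \<longrightarrow> a \<le> Y \<longrightarrow> b \<le> Y \<longrightarrow> c \<le> Y \<longrightarrow> (Y = a \<or> Y = b \<or> Y = c) \<longrightarrow>
    admissible k I \<longrightarrow> admissible k J \<longrightarrow> K \<subseteq> {1..5} \<longrightarrow>
    real (card S) \<le> M * real Y powr e *
      (real (\<Prod>i\<in>{1..5} - I. radpart a i) * real (\<Prod>i\<in>{1..5} - J. radpart b i) *
       real (\<Prod>i\<in>{1..5} - K. radpart c i)) *
      (1 + real (rootpart k a I) * real (rootpart k b J) * real (parts c K) / real Y)"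
proof -
  \<comment> \<open>Three factors Y^e' come from the values of the fixed parts, two from the squared
    divisor count.\<close>
  define e' where "e' = e / 5"
  have e': "e' > 0" using e by (simp add: e'_def)
  have k0: "k > 0" using k by auto
  obtain M1 where M1: "M1 \<ge> 1" "\<And>n Y J. n > 0 \<Longrightarrow> real n \<le> Y \<Longrightarrow> J \<subseteq> {1..5} \<Longrightarrow>
    finite ((\<lambda>m. parts m J) ` {m. near m n}) \<and>
    real (card ((\<lambda>m. parts m J) ` {m. near m n})) \<le> M1 * Y powr e' * real (\<Prod>i\<in>J. radpart n i)"
    using card_parts_values[OF e'] by blast
  obtain M2 where M2: "M2 > 0" "\<And>Y m. Y \<ge> 1 \<Longrightarrow> 0 < (m::nat) \<Longrightarrow> real m \<le> 32 * Y \<Longrightarrow>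
      real (card {d. d dvd m}) \<le> M2 * Y powr e'"
    using divisor_count_bound_32[OF e'] by blast
  define H where "H = (32::real)"
  \<comment> \<open>\<open>lattice_count\<close> contributes \<open>18 * H^8\<close>; the ninth
    factor 32 replaces \<open>C\<close> by the corresponding part of \<open>c\<close>.\<close>
  define W where "W = 18 * H ^ 9"
  have W1: "W \<ge> 1" by (simp add: W_def H_def)
  define M where "M = M1 ^ 3 * M2 ^ 2 * W"
  have "real (card S) \<le> M * real Y powr e *
      (real (\<Prod>i\<in>{1..5} - I. radpart a i) * real (\<Prod>i\<in>{1..5} - J. radpart b i) *
       real (\<Prod>i\<in>{1..5} - K. radpart c i)) *
      (1 + real (rootpart k a I) * real (rootpart k b J) * real (parts c K) / real Y)"
    if bx: "box S \<sigma> \<tau> a b c" and le: "a \<le> Y" "b \<le> Y" "c \<le> Y" and Ym: "Y = a \<or> Y = b \<or> Y = c"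
      and adm: "admissible k I" "admissible k J" and K: "K \<subseteq> {1..5}"
    for S \<sigma> \<tau> a b c I J K and Y :: nat
  proof -
    have I: "I \<subseteq> {1..5}" "J \<subseteq> {1..5}" using adm by (auto simp: admissible_def)
    have pos: "a > 0" "b > 0" "c > 0" and st: "\<bar>\<sigma>\<bar> = 1" "\<bar>\<tau>\<bar> = 1" and finS: "finite S"
      using bx by (auto simp: box_def)
    have Y0: "real Y \<ge> 1" using pos le by linarith
    let ?fa = "\<lambda>m. parts m ({1..5} - I)" and ?fb = "\<lambda>m. parts m ({1..5} - J)" and ?fc = "\<lambda>m. parts m ({1..5} - K)"
    define RA where "RA = ?fa ` {m. near m a}"
    define RB where "RB = ?fb ` {m. near m b}"
    define RC where "RC = ?fc ` {m. near m c}"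
    define f where "f = (\<lambda>(x, y, z). (?fa x, ?fb y, ?fc z))"
    define Z where "Z = real (rootpart k a I) * real (rootpart k b J) * real (parts c K) / real Y"
    define m where "m = (M2 * real Y powr e')^2 * (W * (1 + Z))"
    have Z0: "Z \<ge> 0" by (simp add: Z_def)
    have fib: "real (card {s \<in> S. f s = t}) \<le> m" if "t \<in> RA \<times> RB \<times> RC" for t
    proof (cases "{s \<in> S. f s = t} = {}")
      case True
      show ?thesis unfolding True using W1 Z0 by (simp add: m_def)
    next
      case False
      obtain A B C where t: "t = (A, B, C)" by (metis surj_pair)
      define F where "F = {s \<in> S. f s = t}"
      define h where "h = (\<lambda>(x, y, z::nat). (rootpart k x I, rootpart k y J))"
      have mem: "near x a \<and> near y b \<and> near z c \<and> coprime x y \<and> coprime x z \<and> coprime y z \<and>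
          int z = \<sigma> * int x + \<tau> * int y \<and> x = A * rootpart k x I ^ k \<and> y = B * rootpart k y J ^ k \<and>
          z = C * parts z K \<and> x > 0 \<and> y > 0 \<and> z > 0" if "(x, y, z) \<in> F" for x y z
      proof -
        have 1: "near x a \<and> near y b \<and> near z c \<and> coprime x y \<and> coprime x z \<and> coprime y z \<and>
          int z = \<sigma> * int x + \<tau> * int y" using that bx unfolding F_def box_def by blast
        hence 2: "x > 0" "y > 0" "z > 0" by (auto simp: near_def)
        show ?thesis
          using 1 2 that parts_split[OF 2(1) I(1)] parts_split[OF 2(2) I(2)] parts_split[OF 2(3) K]
          by (simp add: F_def f_def t rootpart_power[OF adm(1)] rootpart_power[OF adm(2)])
      qed
      have memx: "x = A * rootpart k x I ^ k" and memy: "y = B * rootpart k y J ^ k"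
        and memz: "z = C * parts z K" and memr: "int z = \<sigma> * int x + \<tau> * int y"
        if "(x, y, z) \<in> F" for x y z
        using mem[OF that] by blast+
      obtain s where "s \<in> F" using False unfolding F_def by blast
      then obtain x1 y1 z1 where s1: "(x1, y1, z1) \<in> F" by (cases s) blast
      have C1: "C = ?fc z1" "A = ?fa x1" using s1 by (auto simp: F_def f_def t)
      have ABC: "A > 0" "B > 0" "C > 0" using s1 by (auto simp: F_def f_def t)
      have injh: "inj_on h F"
      proof (rule inj_onI)
        fix s s' assume s: "s \<in> F" "s' \<in> F" "h s = h s'"
        obtain x y z x' y' z' where ss: "s = (x, y, z)" "s' = (x', y', z')" by (metis surj_pair)
        have F: "(x, y, z) \<in> F" "(x', y', z') \<in> F" using s(1,2) by (simp_all add: ss)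
        have r: "rootpart k x I = rootpart k x' I" "rootpart k y J = rootpart k y' J"
          using s(3) by (auto simp: h_def ss)
        have "x = x'" using trans[OF memx[OF F(1), unfolded r] memx[OF F(2), symmetric]] .
        moreover have "y = y'" using trans[OF memy[OF F(1), unfolded r] memy[OF F(2), symmetric]] .
        moreover have "int z = \<sigma> * int x + \<tau> * int y" "int z' = \<sigma> * int x' + \<tau> * int y'"
          by (fact memr[OF F(1)] memr[OF F(2)])+
        ultimately show "s = s'" by (simp add: ss)
      qed
      \<comment> \<open>The cofactor has to be a function of u and v; on solutions the value is a
        positive multiple of \<open>C\<close>, so truncation and division are exact.\<close>
      define w where "w u v = nat (\<sigma> * int (A * u ^ k) + \<tau> * int (B * v ^ k)) div C" for u v
      have w: "w (rootpart k x I) (rootpart k y J) = parts z K" if "(x, y, z) \<in> F" for x y z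
      proof -
        have "\<sigma> * int (A * rootpart k x I ^ k) + \<tau> * int (B * rootpart k y J ^ k) = int z"
          using memr[OF that] unfolding memx[OF that, symmetric] memy[OF that, symmetric] by simp
        hence "w (rootpart k x I) (rootpart k y J) = z div C" by (simp add: w_def)
        also have "\<dots> = (C * parts z K) div C" using memz[OF that] by simp
        finally show ?thesis using ABC by simp
      qed
      have hF: "\<exists>x y z. (x, y, z) \<in> F \<and> u = rootpart k x I \<and> v = rootpart k y J" if "(u, v) \<in> h ` F" for u v
        using that by (auto simp: h_def)
      have "real (card (h ` F)) \<le> real (card {d. d dvd C})^2 *
          (1 + 18 * H^8 * (real (rootpart k a I) * real (rootpart k b J) * real c / (real C * real Y)))"
      proof (rule lattice_count[where k = k and A = A and B = B and C = C and w = w and \<sigma> = \<sigma> and \<tau> = \<tau>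
            and ?x0.0 = "real a" and ?y0.0 = "real b"])
        show "finite (h ` F)" using finS by (auto simp: F_def)
        show "coprime A C" using C1 mem[OF s1] coprime_parts[of x1 z1 "{1..5} - I" "{1..5} - K"] by simp
        fix u v assume "(u, v) \<in> h ` F"
        then obtain x y z where s: "(x, y, z) \<in> F" and u: "u = rootpart k x I" and v: "v = rootpart k y J"
          using hF by blast
        note m = mem[OF s]
        have xy: "A * u ^ k = x" "B * v ^ k = y" using memx[OF s] memy[OF s] by (simp_all add: u v)
        have du: "u dvd x" "v dvd y" using xy k0 by (metis dvd_mult dvd_power dvd_refl)+
        have dC: "C dvd z" using memz[OF s] by (metis dvd_triv_left)
        have wz: "C * w u v = z" using memz[OF s] w[OF s] by (simp add: u v)
        show "0 < u \<and> 0 < v \<and> coprime u v \<and> coprime u C \<and> coprime v C"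
          using m du dC u v by (meson coprime_divisors rootpart_pos)
        show "int (C * w u v) = \<sigma> * int (A * u^k) + \<tau> * int (B * v^k)"
          unfolding xy wz by (rule memr[OF s])
        show "real (A * u^k) \<le> H * real a \<and> real a \<le> H * real (A * u^k)"
          using near_le[of x a] m pos unfolding xy H_def by linarith
        show "real (B * v^k) \<le> H * real b \<and> real b \<le> H * real (B * v^k)"
          using near_le[of y b] m pos unfolding xy H_def by linarith
        show "real (C * w u v) \<le> H * real c"
          unfolding wz using near_le[of z c] m pos unfolding H_def by linarith
        show "real u \<le> H * real (rootpart k a I)"
          using rootpart_le_near[of x a k I] m adm k0 unfolding u H_def by linarith
        show "real v \<le> H * real (rootpart k b J) \<and> real (rootpart k b J) \<le> H * real v"
          using rootpart_le_near[of y b k J] m adm k0 unfolding v H_def by linarith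
      qed (use k pos st ABC le Ym Y0 in \<open>auto simp: H_def\<close>)
      also have "\<dots> \<le> (M2 * real Y powr e')^2 * (W * (1 + Z))"
      proof (intro mult_mono power_mono)
        have "C dvd z1" using memz[OF s1] by (metis dvd_triv_left)
        hence "C \<le> z1" using mem[OF s1] by (intro dvd_imp_le) auto
        also have "\<dots> \<le> 32 * c" using near_le mem[OF s1] pos by blast
        finally have "real C \<le> 32 * real Y" using le by linarith
        thus "real (card {d. d dvd C}) \<le> M2 * real Y powr e'" using M2(2)[OF Y0] ABC by blast
        have "real c = real (?fc c) * real (parts c K)"
          using parts_split[OF pos(3) K] by (metis of_nat_mult)
        also have "\<dots> \<le> (32 * real C) * real (parts c K)"
        proof (intro mult_right_mono)
          show "real (?fc c) \<le> 32 * real C"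
            using parts_le_near(2)[of z1 c "{1..5} - K"] mem[OF s1] unfolding C1(1) by fastforce
        qed simp
        finally have "real c / (real C * real Y) \<le> 32 * real (parts c K) / real Y"
          using ABC Y0 by (simp add: field_simps)
        hence "real (rootpart k a I) * real (rootpart k b J) * (real c / (real C * real Y))
            \<le> (real (rootpart k a I) * real (rootpart k b J)) * (32 * real (parts c K) / real Y)"
          by (intro mult_left_mono) auto
        also have "\<dots> = 32 * Z" by (simp add: Z_def)
        finally have "18 * H^8 * (real (rootpart k a I) * real (rootpart k b J) * (real c / (real C * real Y)))
            \<le> 18 * H^8 * (32 * Z)"
          by (rule mult_left_mono) (simp add: H_def)
        hence "18 * H^8 * (real (rootpart k a I) * real (rootpart k b J) * real c / (real C * real Y)) \<le> W * Z"
          by (simp add: W_def H_def)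
        moreover have "W * (1 + Z) = W + W * Z" by (simp add: algebra_simps)
        ultimately show "1 + 18 * H^8 * (real (rootpart k a I) * real (rootpart k b J) * real c / (real C * real Y)) \<le> W * (1 + Z)"
          using W1 by linarith
      qed (use H_def in auto)
      finally show ?thesis
        using card_image[OF injh] by (simp add: m_def F_def)
    qed
    have RA: "finite RA" "real (card RA) \<le> M1 * real Y powr e' * real (\<Prod>i\<in>{1..5} - I. radpart a i)"
      using M1(2)[of a "real Y" "{1..5} - I"] pos le unfolding RA_def by auto
    have RB: "finite RB" "real (card RB) \<le> M1 * real Y powr e' * real (\<Prod>i\<in>{1..5} - J. radpart b i)"
      using M1(2)[of b "real Y" "{1..5} - J"] pos le unfolding RB_def by auto
    have RC: "finite RC" "real (card RC) \<le> M1 * real Y powr e' * real (\<Prod>i\<in>{1..5} - K. radpart c i)"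
      using M1(2)[of c "real Y" "{1..5} - K"] pos le unfolding RC_def by auto
    have "real (card S) \<le> real (card (RA \<times> RB \<times> RC)) * m"
    proof (rule card_le_fibres[OF finS _ _ fib])
      show "finite (RA \<times> RB \<times> RC)" using RA RB RC by auto
      show "f ` S \<subseteq> RA \<times> RB \<times> RC"
        using bx by (auto simp: f_def RA_def RB_def RC_def box_def)
    qed
    also have "real (card (RA \<times> RB \<times> RC)) = real (card RA) * real (card RB) * real (card RC)"
      by (simp add: card_cartesian_product)
    also have "\<dots> * m \<le> ((M1 * real Y powr e' * real (\<Prod>i\<in>{1..5} - I. radpart a i)) *
        (M1 * real Y powr e' * real (\<Prod>i\<in>{1..5} - J. radpart b i)) *
        (M1 * real Y powr e' * real (\<Prod>i\<in>{1..5} - K. radpart c i))) * m"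
      using RA(2) RB(2) RC(2) W1 Z0 M1(1)
      by (intro mult_right_mono mult_mono) (auto simp: m_def intro!: mult_nonneg_nonneg prod_nonneg)
    also have "\<dots> = M * (real Y powr e') ^ 5 *
      (real (\<Prod>i\<in>{1..5} - I. radpart a i) * real (\<Prod>i\<in>{1..5} - J. radpart b i) *
       real (\<Prod>i\<in>{1..5} - K. radpart c i)) * (1 + Z)"
      by (simp add: m_def M_def power_numeral_reduce mult_ac)
    also have "(real Y powr e') ^ 5 = real Y powr e"
      using Y0 powr_realpow[of "real Y powr e'" 5] by (simp add: powr_powr e'_def)
    finally show ?thesis by (simp add: Z_def)
  qed
  moreover have "M > 0" using M1(1) M2(1) W1 by (simp add: M_def)
  ultimately show ?thesis by blast
qed

lemma energy_count_symmetric: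
  fixes S :: "(nat \<times> nat) set" and U V \<Gamma> :: "nat set" and A B k l N :: nat and \<sigma> \<tau> :: int
    and z :: "nat \<Rightarrow> nat \<Rightarrow> nat" and D :: real
  assumes fin: "finite U" "finite V" "finite \<Gamma>" and sub: "S \<subseteq> U \<times> V" and kl: "k \<ge> 2" "l \<ge> 2"
    and pos: "A > 0" "B > 0" and st: "\<bar>\<sigma>\<bar> = 1" "\<bar>\<tau>\<bar> = 1"
    and eq: "\<And>u v. (u, v) \<in> S \<Longrightarrow> z u v \<in> \<Gamma> \<and> int (z u v) = \<sigma> * int (A * u^k) + \<tau> * int (B * v^l)"
    and N: "\<And>u v. (u, v) \<in> S \<Longrightarrow> A * u^k \<le> N \<and> B * v^l \<le> N"
    and D: "D \<ge> 0" "\<And>m. 0 < m \<Longrightarrow> m \<le> N \<Longrightarrow> real (card {d. d dvd m}) \<le> D"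
  shows "real (card S)^2 \<le> real (card \<Gamma>) * (real (card U) * real (card V) * (1 + 2 * D))"
proof (cases "card U \<le> card V")
  case True
  show ?thesis
    by (rule energy_count[OF fin sub _ kl(2) pos st eq _ D True]) (use kl N in auto)
next
  case False
  have "real (card (prod.swap ` S))^2 \<le> real (card \<Gamma>) * (real (card V) * real (card U) * (1 + 2 * D))"
    by (rule energy_count[OF fin(2,1,3) _ _ kl(1) pos(2,1) st(2,1) _ _ D, where z = "\<lambda>v u. z u v" and k = l])
      (use kl N sub False eq in auto)
  also have "card (prod.swap ` S) = card S" by (intro card_image) (auto simp: inj_on_def)
  finally show ?thesis by (simp add: mult_ac)
qed

lemma card_rootpart_values:
  assumes "admissible k I" "k > 0" "finite ((\<lambda>m. parts m I) ` T)"
  shows "finite ((\<lambda>m. rootpart k m I) ` T)"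
    "card ((\<lambda>m. rootpart k m I) ` T) \<le> card ((\<lambda>m. parts m I) ` T)"
proof -
  have eq: "(\<lambda>m. parts m I) ` T = (\<lambda>u. u ^ k) ` ((\<lambda>m. rootpart k m I) ` T)"
    by (simp add: image_image rootpart_power[OF assms(1)])
  have inj: "inj_on (\<lambda>u::nat. u ^ k) X" for X
    using assms(2) by (auto simp: inj_on_def power_eq_iff_eq_base)
  show "finite ((\<lambda>m. rootpart k m I) ` T)" using assms(3) finite_imageD[OF _ inj] unfolding eq by blast
  show "card ((\<lambda>m. rootpart k m I) ` T) \<le> card ((\<lambda>m. parts m I) ` T)"
    unfolding eq by (simp add: card_image[OF inj])
qed

text \<open>Only parts of the first two numbers are fixed. The third is not split: it ranges over a
  set of about rad(c) values, and this count enters under the square root together with those of u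
  and v.\<close>

lemma box_energy_bound:
  fixes e :: real
  assumes e: "e > 0" and k: "k \<ge> 2" and l: "l \<ge> 2"
  shows "\<exists>M>0. \<forall>S \<sigma> \<tau> a b c I J (Y::nat).
    box S \<sigma> \<tau> a b c \<longrightarrow> a \<le> Y \<longrightarrow> b \<le> Y \<longrightarrow> c \<le> Y \<longrightarrow>
    admissible k I \<longrightarrow> admissible l J \<longrightarrow>
    real (card S) \<le> M * real Y powr e *
      (real (\<Prod>i\<in>{1..5} - I. radpart a i) * real (\<Prod>i\<in>{1..5} - J. radpart b i)) *
      sqrt (real (\<Prod>i\<in>I. radpart a i) * real (\<Prod>i\<in>J. radpart b i) * real (\<Prod>i\<in>{1..5}. radpart c i))"
proof -
  \<comment> \<open>Two factors Y^e' come from the fixed parts. Four more, from the sizes of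
    \<open>\<Gamma>\<close>, \<open>U\<close>, \<open>V\<close> and the divisor bound, stand under
    the square root and count as two.\<close>
  define e' where "e' = e / 4"
  have e': "e' > 0" using e by (simp add: e'_def)
  have kl0: "k > 0" "l > 0" using k l by auto
  obtain M1 where M1: "M1 \<ge> 1" "\<And>n Y J. n > 0 \<Longrightarrow> real n \<le> Y \<Longrightarrow> J \<subseteq> {1..5} \<Longrightarrow>
    finite ((\<lambda>m. parts m J) ` {m. near m n}) \<and>
    real (card ((\<lambda>m. parts m J) ` {m. near m n})) \<le> M1 * Y powr e' * real (\<Prod>i\<in>J. radpart n i)"
    using card_parts_values[OF e'] by blast
  obtain M2 where M2: "M2 > 0" "\<And>Y m. Y \<ge> 1 \<Longrightarrow> 0 < (m::nat) \<Longrightarrow> real m \<le> 32 * Y \<Longrightarrow>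
      real (card {d. d dvd m}) \<le> M2 * Y powr e'"
    using divisor_count_bound_32[OF e'] by blast
  define W where "W = M1 ^ 3 * (1 + 2 * M2)"
  have W0: "W > 0" using M1(1) M2(1) by (simp add: W_def)
  define M where "M = M1 ^ 2 * sqrt W"
  have "real (card S) \<le> M * real Y powr e *
      (real (\<Prod>i\<in>{1..5} - I. radpart a i) * real (\<Prod>i\<in>{1..5} - J. radpart b i)) *
      sqrt (real (\<Prod>i\<in>I. radpart a i) * real (\<Prod>i\<in>J. radpart b i) * real (\<Prod>i\<in>{1..5}. radpart c i))"
    if bx: "box S \<sigma> \<tau> a b c" and le: "a \<le> Y" "b \<le> Y" "c \<le> Y"
      and adm: "admissible k I" "admissible l J"
    for S \<sigma> \<tau> a b c I J and Y :: nat
  proof -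
    have I: "I \<subseteq> {1..5}" "J \<subseteq> {1..5}" using adm by (auto simp: admissible_def)
    have pos: "a > 0" "b > 0" "c > 0" and st: "\<bar>\<sigma>\<bar> = 1" "\<bar>\<tau>\<bar> = 1" and finS: "finite S"
      using bx by (auto simp: box_def)
    have Y0: "real Y \<ge> 1" using pos le by linarith
    let ?fa = "\<lambda>m. parts m ({1..5} - I)" and ?fb = "\<lambda>m. parts m ({1..5} - J)"
    define RA where "RA = ?fa ` {m. near m a}"
    define RB where "RB = ?fb ` {m. near m b}"
    define U where "U = (\<lambda>m. rootpart k m I) ` {m. near m a}"
    define V where "V = (\<lambda>m. rootpart l m J) ` {m. near m b}"
    define \<Gamma> where "\<Gamma> = (\<lambda>m. parts m {1..5}) ` {m. near m c}"
    define f where "f = (\<lambda>(x, y, z::nat). (?fa x, ?fb y))"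
    define pA where "pA = real (\<Prod>i\<in>I. radpart a i)"
    define pB where "pB = real (\<Prod>i\<in>J. radpart b i)"
    define pC where "pC = real (\<Prod>i\<in>{1..5}. radpart c i)"
    have p0: "pA \<ge> 0" "pB \<ge> 0" "pC \<ge> 0" unfolding pA_def pB_def pC_def by (rule of_nat_0_le_iff)+
    define y where "y = real Y powr e'"
    have y1: "y \<ge> 1" using Y0 e' by (simp add: y_def ge_one_powr_ge_zero)
    have RA: "finite RA" "real (card RA) \<le> M1 * y * real (\<Prod>i\<in>{1..5} - I. radpart a i)"
      using M1(2)[of a "real Y" "{1..5} - I"] pos le unfolding RA_def y_def by auto
    have RB: "finite RB" "real (card RB) \<le> M1 * y * real (\<Prod>i\<in>{1..5} - J. radpart b i)"
      using M1(2)[of b "real Y" "{1..5} - J"] pos le unfolding RB_def y_def by auto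
    have \<Gamma>: "finite \<Gamma>" "real (card \<Gamma>) \<le> M1 * y * pC"
      using M1(2)[of c "real Y" "{1..5}"] pos le unfolding \<Gamma>_def y_def pC_def by auto
    have a0: "finite ((\<lambda>m. parts m I) ` {m. near m a})"
        "real (card ((\<lambda>m. parts m I) ` {m. near m a})) \<le> M1 * y * pA"
      using M1(2)[of a "real Y" I] pos le I unfolding y_def pA_def by auto
    have U: "finite U" "real (card U) \<le> M1 * y * pA"
      using card_rootpart_values[OF adm(1) kl0(1) a0(1)] a0(2) unfolding U_def by linarith+
    have b0: "finite ((\<lambda>m. parts m J) ` {m. near m b})"
        "real (card ((\<lambda>m. parts m J) ` {m. near m b})) \<le> M1 * y * pB"
      using M1(2)[of b "real Y" J] pos le I unfolding y_def pB_def by auto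
    have V: "finite V" "real (card V) \<le> M1 * y * pB"
      using card_rootpart_values[OF adm(2) kl0(2) b0(1)] b0(2) unfolding V_def by linarith+
    define m where "m = y ^ 2 * (sqrt W * sqrt (pA * pB * pC))"
    have fib: "real (card {s \<in> S. f s = t}) \<le> m" if "t \<in> RA \<times> RB" for t
    proof (cases "{s \<in> S. f s = t} = {}")
      case True
      show ?thesis unfolding True using W0 p0 by (simp add: m_def)
    next
      case False
      obtain A B where t: "t = (A, B)" by (metis surj_pair)
      define F where "F = {s \<in> S. f s = t}"
      define h where "h = (\<lambda>(x, y, z::nat). (rootpart k x I, rootpart l y J))"
      have nr: "near x a \<and> near y b \<and> near z c" and memr: "int z = \<sigma> * int x + \<tau> * int y"
        and memx: "x = A * rootpart k x I ^ k" and memy: "y = B * rootpart l y J ^ l"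
        if "(x, y, z) \<in> F" for x y z
      proof -
        show 1: "near x a \<and> near y b \<and> near z c" "int z = \<sigma> * int x + \<tau> * int y"
          using that bx unfolding F_def box_def by blast+
        hence 2: "x > 0" "y > 0" by (auto simp: near_def)
        show "x = A * rootpart k x I ^ k" "y = B * rootpart l y J ^ l"
          using that parts_split[OF 2(1) I(1)] parts_split[OF 2(2) I(2)]
          by (simp_all add: F_def f_def t rootpart_power[OF adm(1)] rootpart_power[OF adm(2)])
      qed
      have ABC: "A > 0" "B > 0" using False by (auto simp: f_def t)
      have injh: "inj_on h F"
      proof (rule inj_onI)
        fix s s' assume s: "s \<in> F" "s' \<in> F" "h s = h s'"
        obtain x y z x' y' z' where ss: "s = (x, y, z)" "s' = (x', y', z')" by (metis surj_pair)
        have F: "(x, y, z) \<in> F" "(x', y', z') \<in> F" using s(1,2) by (simp_all add: ss)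
        have r: "rootpart k x I = rootpart k x' I" "rootpart l y J = rootpart l y' J"
          using s(3) by (auto simp: h_def ss)
        have "x = x'" using trans[OF memx[OF F(1), unfolded r] memx[OF F(2), symmetric]] .
        moreover have "y = y'" using trans[OF memy[OF F(1), unfolded r] memy[OF F(2), symmetric]] .
        moreover have "int z = \<sigma> * int x + \<tau> * int y" "int z' = \<sigma> * int x' + \<tau> * int y'"
          by (fact memr[OF F(1)] memr[OF F(2)])+
        ultimately show "s = s'" by (simp add: ss)
      qed
      define w where "w u v = nat (\<sigma> * int (A * u ^ k) + \<tau> * int (B * v ^ l))" for u v
      have hF: "\<exists>x y z. (x, y, z) \<in> F \<and> u = rootpart k x I \<and> v = rootpart l y J" if "(u, v) \<in> h ` F" for u v
        using that by (auto simp: h_def)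
      have "real (card (h ` F))^2 \<le> real (card \<Gamma>) * (real (card U) * real (card V) * (1 + 2 * (M2 * y)))"
      proof (rule energy_count_symmetric[OF U(1) V(1) \<Gamma>(1) _ k l ABC st, where z = w and N = "32 * Y"])
        show "h ` F \<subseteq> U \<times> V" using nr by (auto simp: h_def U_def V_def)
        show "0 \<le> M2 * y" using M2(1) y1 by simp
        show "real (card {d. d dvd m}) \<le> M2 * y" if "0 < m" "m \<le> 32 * Y" for m
          unfolding y_def using that by (intro M2(2)[OF Y0]) auto
        fix u v assume "(u, v) \<in> h ` F"
        then obtain x y z where s: "(x, y, z) \<in> F" and u: "u = rootpart k x I" and v: "v = rootpart l y J"
          using hF by blast
        have xy: "A * u ^ k = x" "B * v ^ l = y" using memx[OF s] memy[OF s] by (simp_all add: u v)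
        have wz: "w u v = z" unfolding w_def xy memr[OF s, symmetric] by simp
        have "z = parts z {1..5}" using nr[OF s] parts_all[of z] by (simp add: near_def)
        hence "z \<in> \<Gamma>" using nr[OF s] unfolding \<Gamma>_def by blast
        thus "w u v \<in> \<Gamma> \<and> int (w u v) = \<sigma> * int (A * u^k) + \<tau> * int (B * v^l)"
          unfolding xy wz using memr[OF s] by blast
        show "A * u^k \<le> 32 * Y \<and> B * v^l \<le> 32 * Y"
          unfolding xy using near_le[of x a] near_le[of y b] nr[OF s] pos le by fastforce
      qed
      also have "\<dots> \<le> (M1 * y * pC) * ((M1 * y * pA) * (M1 * y * pB) * (y * (1 + 2 * M2)))"
      proof -
        have "1 + 2 * (M2 * y) \<le> y * (1 + 2 * M2)" using y1 by (simp add: algebra_simps)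
        thus ?thesis using \<Gamma>(2) U(2) V(2) M1(1) M2(1) y1 p0 by (intro mult_mono) auto
      qed
      also have "\<dots> = (y ^ 2)^2 * (W * (pA * pB * pC))"
        by (simp add: W_def power_numeral_reduce mult_ac)
      finally have "real (card (h ` F)) \<le> sqrt ((y ^ 2)^2 * (W * (pA * pB * pC)))"
        by (rule real_le_rsqrt)
      also have "\<dots> = m" unfolding m_def real_sqrt_mult real_sqrt_abs by simp
      finally show ?thesis
        using card_image[OF injh] by (simp add: F_def)
    qed
    have "real (card S) \<le> real (card (RA \<times> RB)) * m"
    proof (rule card_le_fibres[OF finS _ _ fib])
      show "finite (RA \<times> RB)" using RA RB by auto
      show "f ` S \<subseteq> RA \<times> RB"
        using bx by (auto simp: f_def RA_def RB_def box_def)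
    qed
    also have "real (card (RA \<times> RB)) = real (card RA) * real (card RB)"
      by (simp add: card_cartesian_product)
    also have "\<dots> * m \<le> ((M1 * y * real (\<Prod>i\<in>{1..5} - I. radpart a i)) *
        (M1 * y * real (\<Prod>i\<in>{1..5} - J. radpart b i))) * m"
      using RA(2) RB(2) W0 p0 y1 M1(1)
      by (intro mult_right_mono mult_mono) (auto simp: m_def intro!: mult_nonneg_nonneg prod_nonneg)
    also have "\<dots> = M * y ^ 4 *
      (real (\<Prod>i\<in>{1..5} - I. radpart a i) * real (\<Prod>i\<in>{1..5} - J. radpart b i)) * sqrt (pA * pB * pC)"
      by (simp add: m_def M_def power_numeral_reduce mult_ac)
    also have "y ^ 4 = real Y powr e"
      using Y0 powr_realpow[of "real Y powr e'" 4] by (simp add: y_def powr_powr e'_def)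
    finally show ?thesis by (simp add: pA_def pB_def pC_def)
  qed
  moreover have "M > 0" using M1(1) W0 by (simp add: M_def)
  ultimately show ?thesis by blast
qed

section \<open>The linear programme\<close>

text \<open>The relations between radicals and parts of a number n <= Y on the logarithmic scale;
  the total of at most 1 expresses n <= Y.\<close>

definition profile :: "(nat \<Rightarrow> real) \<Rightarrow> (nat \<Rightarrow> real) \<Rightarrow> bool" where
  "profile x w \<longleftrightarrow> (\<forall>i. 0 \<le> x i) \<and> (\<forall>i\<in>{1..4}. w i = real i * x i) \<and> 5 * x 5 \<le> w 5 \<and>
     (\<Sum>i\<in>{1..5}. w i) \<le> 1"

text \<open>
  For a reference triple with largest entry \<open>Y\<close>, the numbers \<open>x i\<close> and \<open>w i\<close> are the logarithms to
  base \<open>Y\<close> of \<open>radpart\<close> and \<open>part\<close>. The next two predicates say that the bounds of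
  \<open>box_lattice_bound\<close> and \<open>box_energy_bound\<close> have exponent at most \<open>0.6\<close>; the number \<open>1.6\<close>
  is \<open>0.6 + 1\<close>, where \<open>1\<close> is the exponent of the denominator \<open>Y\<close>.
\<close>

definition lattice_saves ::
  "nat \<Rightarrow> (nat \<Rightarrow> real) \<Rightarrow> (nat \<Rightarrow> real) \<Rightarrow> (nat \<Rightarrow> real) \<Rightarrow> (nat \<Rightarrow> real) \<Rightarrow> (nat \<Rightarrow> real) \<Rightarrow> (nat \<Rightarrow> real) \<Rightarrow> bool"
where
  "lattice_saves k x w y v z u \<longleftrightarrow> (\<exists>I J K. admissible k I \<and> admissible k J \<and> K \<subseteq> {1..5} \<and>
     sum x ({1..5} - I) + sum y ({1..5} - J) + sum z ({1..5} - K) \<le> 0.6 \<and>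
     sum x ({1..5} - I) + sum y ({1..5} - J) + sum z ({1..5} - K)
       + (sum w I + sum v J) / real k + sum u K \<le> 1.6)"

definition energy_saves :: "(nat \<Rightarrow> real) \<Rightarrow> (nat \<Rightarrow> real) \<Rightarrow> (nat \<Rightarrow> real) \<Rightarrow> bool" where
  "energy_saves x y z \<longleftrightarrow> sum x ({1..5} - {3}) + sum y ({1..5} - {2,4})
     + (sum x {3} + sum y {2,4} + sum z {1..5}) / 2 \<le> 0.6"

definition saves ::
  "(nat \<Rightarrow> real) \<Rightarrow> (nat \<Rightarrow> real) \<Rightarrow> (nat \<Rightarrow> real) \<Rightarrow> (nat \<Rightarrow> real) \<Rightarrow> (nat \<Rightarrow> real) \<Rightarrow> (nat \<Rightarrow> real) \<Rightarrow> bool"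
where
  "saves x w y v z u \<longleftrightarrow> (\<exists>k\<in>{1,2,3}. lattice_saves k x w y v z u) \<or> energy_saves x y z"

text \<open>All assignments of the three numbers to the roles in the bounds; each corresponds to a
  permuted \<open>box\<close>.\<close>

definition some_saves ::
  "(nat \<Rightarrow> real) \<Rightarrow> (nat \<Rightarrow> real) \<Rightarrow> (nat \<Rightarrow> real) \<Rightarrow> (nat \<Rightarrow> real) \<Rightarrow> (nat \<Rightarrow> real) \<Rightarrow> (nat \<Rightarrow> real) \<Rightarrow> bool"
where
  "some_saves x w y v z u \<longleftrightarrow> saves x w y v z u \<or> saves x w z u y v \<or> saves y v x w z u \<or>
     saves y v z u x w \<or> saves z u x w y v \<or> saves z u y v x w"

lemma lattice_saves_dest:
  assumes "\<not> saves x w y v z u" "k \<in> {1,2,3}" "admissible k I" "admissible k J" "K \<subseteq> {1..5}"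
  shows "0.6 < sum x ({1..5} - I) + sum y ({1..5} - J) + sum z ({1..5} - K) \<or>
    1.6 < sum x ({1..5} - I) + sum y ({1..5} - J) + sum z ({1..5} - K)
       + (sum w I + sum v J) / real k + sum u K"
  using assms unfolding saves_def lattice_saves_def not_le[symmetric] by blast

lemma atLeastAtMost_1_5: "{1..5::nat} = {1,2,3,4,5}"
  by auto

text \<open>The ordering by the exponents of the cube parts lets the number with the largest one
  supply the cube in the energy bound. Energy then enters with the square variable in either of the
  other two. In \<open>Lz\<close>, \<open>Lx\<close>, \<open>Ly\<close> the letter names the number
  that provides the modulus.\<close>

lemma some_saves_ordered:
  assumes xw: "profile x w" and yv: "profile y v" and zu: "profile z u"
    and sum: "sum x {1..5} + sum y {1..5} + sum z {1..5} \<le> 1" and ord: "y 3 \<le> x 3" "z 3 \<le> y 3"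
  shows "some_saves x w y v z u"
proof (rule ccontr)
  assume "\<not> some_saves x w y v z u"
  hence no: "\<not> saves x w y v z u" "\<not> saves y v z u x w" "\<not> saves x w z u y v"
    by (auto simp: some_saves_def)
  have w: "w 1 = x 1" "w 2 = 2 * x 2" "w 3 = 3 * x 3" "w 4 = 4 * x 4" "5 * x 5 \<le> w 5"
      "w 1 + w 2 + w 3 + w 4 + w 5 \<le> 1" "0 \<le> x 1" "0 \<le> x 2" "0 \<le> x 3" "0 \<le> x 4" "0 \<le> x 5"
    and v: "v 1 = y 1" "v 2 = 2 * y 2" "v 3 = 3 * y 3" "v 4 = 4 * y 4" "5 * y 5 \<le> v 5"
      "v 1 + v 2 + v 3 + v 4 + v 5 \<le> 1" "0 \<le> y 1" "0 \<le> y 2" "0 \<le> y 3" "0 \<le> y 4" "0 \<le> y 5"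
    and u: "u 1 = z 1" "u 2 = 2 * z 2" "u 3 = 3 * z 3" "u 4 = 4 * z 4" "5 * z 5 \<le> u 5"
      "u 1 + u 2 + u 3 + u 4 + u 5 \<le> 1" "0 \<le> z 1" "0 \<le> z 2" "0 \<le> z 3" "0 \<le> z 4" "0 \<le> z 5"
    using xw yv zu unfolding profile_def atLeastAtMost_1_5 by auto
  have s: "x 1 + x 2 + x 3 + x 4 + x 5 + (y 1 + y 2 + y 3 + y 4 + y 5) + (z 1 + z 2 + z 3 + z 4 + z 5) \<le> 1"
    using sum unfolding atLeastAtMost_1_5 by simp
  have energy: "0.6 < x 1 + x 2 + x 4 + x 5 + (y 1 + y 3 + y 5) + (x 3 + y 2 + y 4 + (z 1 + z 2 + z 3 + z 4 + z 5)) / 2"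
    "0.6 < x 1 + x 2 + x 4 + x 5 + (z 1 + z 3 + z 5) + (x 3 + z 2 + z 4 + (y 1 + y 2 + y 3 + y 4 + y 5)) / 2"
    using no(1,3) unfolding saves_def energy_saves_def atLeastAtMost_1_5
    by (simp_all add: insert_Diff_if add.assoc)
  \<comment> \<open>This selection of instances was found by a branch-and-bound search over linear programs.\<close>
  note Lz = lattice_saves_dest[OF no(1)] and Lx = lattice_saves_dest[OF no(2)] and Ly = lattice_saves_dest[OF no(3)]
  note raw_instances =
    Lx[of 2 "{2,4}" "{2,4}" "{1,2,4,5}"]
    Lx[of 2 "{2,4}" "{2,4}" "{1}"]
    Lx[of 2 "{4}" "{2,4}" "{1,2}"]
    Lx[of 3 "{3}" "{3}" "{}"]
    Ly[of 2 "{2,4}" "{2,4}" "{1,2,3}"]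
    Ly[of 2 "{2}" "{2}" "{1,2,3}"]
    Ly[of 2 "{2}" "{4}" "{1,3}"]
    Ly[of 2 "{4}" "{4}" "{1}"]
    Ly[of 3 "{3}" "{3}" "{1,2,3}"]
    Ly[of 3 "{3}" "{3}" "{1,3,5}"]
    Ly[of 3 "{3}" "{}" "{1,2,3}"]
    Ly[of 3 "{3}" "{}" "{1,2,4}"]
    Lz[of 1 "{1,2,3}" "{1,2,3}" "{1,2}"]
    Lz[of 1 "{1,2,3}" "{1,2}" "{1,2,3,5}"]
    Lz[of 1 "{1,2}" "{1,2,3}" "{1,2}"]
    Lz[of 1 "{1,3}" "{1,2}" "{1,2,3}"]
    Lz[of 1 "{1,3}" "{1}" "{1,3}"]
    Lz[of 1 "{1,3}" "{1}" "{1}"]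
    Lz[of 1 "{1,3}" "{1}" "{}"]
    Lz[of 2 "{2,4}" "{4}" "{1}"]
    Lz[of 3 "{3}" "{3}" "{1,2,3}"]
    Lz[of 3 "{3}" "{3}" "{1,2,5}"]
  \<comment> \<open>Each instance is a disjunction of two strict linear inequalities, so the
    contradiction is a finite case split with linear real arithmetic in every branch.\<close>
  note instances = raw_instances[unfolded atLeastAtMost_1_5 admissible_def, simplified insert_Diff_if, simplified]
  show False
    using [[argo_timeout = 600]] instances energy[unfolded One_nat_def] s[unfolded One_nat_def] ord
      w[unfolded One_nat_def] v[unfolded One_nat_def] u[unfolded One_nat_def] by argo
qed

lemma some_saves:
  assumes "profile x w" "profile y v" "profile z u" "sum x {1..5} + sum y {1..5} + sum z {1..5} \<le> 1"
  shows "some_saves x w y v z u"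
proof -
  have "(y 3 \<le> x 3 \<and> z 3 \<le> y 3) \<or> (z 3 \<le> x 3 \<and> y 3 \<le> z 3) \<or> (x 3 \<le> y 3 \<and> z 3 \<le> x 3) \<or>
    (z 3 \<le> y 3 \<and> x 3 \<le> z 3) \<or> (x 3 \<le> z 3 \<and> y 3 \<le> x 3) \<or> (y 3 \<le> z 3 \<and> x 3 \<le> y 3)"
    by linarith
  hence "some_saves x w y v z u \<or> some_saves x w z u y v \<or> some_saves y v x w z u \<or>
     some_saves y v z u x w \<or> some_saves z u x w y v \<or> some_saves z u y v x w"
    using assms by (auto intro: some_saves_ordered simp: add_ac)
  thus ?thesis unfolding some_saves_def by blast
qed

section \<open>Assembling the bound\<close>

abbreviation radlog :: "nat \<Rightarrow> nat \<Rightarrow> nat \<Rightarrow> real" where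
  "radlog Y n i \<equiv> log (real Y) (real (radpart n i))"

abbreviation partlog :: "nat \<Rightarrow> nat \<Rightarrow> nat \<Rightarrow> real" where
  "partlog Y n i \<equiv> log (real Y) (real (part n i))"

lemma prod_eq_powr_sum_log:
  fixes f :: "nat \<Rightarrow> nat"
  assumes "Y \<ge> 2" "\<And>i. f i > 0" "finite J"
  shows "real (\<Prod>i\<in>J. f i) = real Y powr (\<Sum>i\<in>J. log (real Y) (real (f i)))"
  using assms by (simp add: powr_sum powr_log_cancel)

lemma rootpart_eq_powr:
  assumes "Y \<ge> 2" "admissible k I" "k > 0"
  shows "real (rootpart k n I) = real Y powr (sum (partlog Y n) I / real k)"
proof -
  have fin: "finite I" using assms(2) finite_subset by (auto simp: admissible_def)
  have "real (rootpart k n I) ^ k = real Y powr (sum (partlog Y n) I)"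
    using rootpart_power[OF assms(2), of n] prod_eq_powr_sum_log[OF assms(1) _ fin, of "part n"]
    by (simp add: parts_def flip: of_nat_power)
  hence "(real (rootpart k n I) ^ k) powr (1 / real k) = real Y powr (sum (partlog Y n) I / real k)"
    by (simp add: powr_powr)
  moreover have "(real (rootpart k n I) ^ k) powr (1 / real k) = real (rootpart k n I)"
    using assms(3) by (simp add: powr_powr flip: powr_realpow)
  ultimately show ?thesis by simp
qed

lemma box_saving_bound:
  fixes e :: real
  assumes e: "e > 0"
  shows "\<exists>M>0. \<forall>S \<sigma> \<tau> a b c (Y::nat). box S \<sigma> \<tau> a b c \<longrightarrow> a \<le> Y \<longrightarrow> b \<le> Y \<longrightarrow> c \<le> Y \<longrightarrow>
    (Y = a \<or> Y = b \<or> Y = c) \<longrightarrow> Y \<ge> 2 \<longrightarrow>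
    saves (radlog Y a) (partlog Y a) (radlog Y b) (partlog Y b) (radlog Y c) (partlog Y c) \<longrightarrow>
    real (card S) \<le> M * real Y powr (0.6 + e)"
proof -
  have "\<forall>k. \<exists>M>0. k \<in> {1,2,3} \<longrightarrow> (\<forall>S \<sigma> \<tau> a b c I J K (Y::nat).
    box S \<sigma> \<tau> a b c \<longrightarrow> a \<le> Y \<longrightarrow> b \<le> Y \<longrightarrow> c \<le> Y \<longrightarrow> (Y = a \<or> Y = b \<or> Y = c) \<longrightarrow>
    admissible k I \<longrightarrow> admissible k J \<longrightarrow> K \<subseteq> {1..5} \<longrightarrow>
    real (card S) \<le> M * real Y powr e *
      (real (\<Prod>i\<in>{1..5} - I. radpart a i) * real (\<Prod>i\<in>{1..5} - J. radpart b i) *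
       real (\<Prod>i\<in>{1..5} - K. radpart c i)) *
      (1 + real (rootpart k a I) * real (rootpart k b J) * real (parts c K) / real Y))"
  proof
    fix k :: nat
    show "\<exists>M>0. k \<in> {1,2,3} \<longrightarrow> (\<forall>S \<sigma> \<tau> a b c I J K (Y::nat).
    box S \<sigma> \<tau> a b c \<longrightarrow> a \<le> Y \<longrightarrow> b \<le> Y \<longrightarrow> c \<le> Y \<longrightarrow> (Y = a \<or> Y = b \<or> Y = c) \<longrightarrow>
    admissible k I \<longrightarrow> admissible k J \<longrightarrow> K \<subseteq> {1..5} \<longrightarrow>
    real (card S) \<le> M * real Y powr e *
      (real (\<Prod>i\<in>{1..5} - I. radpart a i) * real (\<Prod>i\<in>{1..5} - J. radpart b i) *
       real (\<Prod>i\<in>{1..5} - K. radpart c i)) *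
      (1 + real (rootpart k a I) * real (rootpart k b J) * real (parts c K) / real Y))"
    proof (cases "k \<in> {1,2,3}")
      case True
      show ?thesis using box_lattice_bound[OF e True] by blast
    next
      case False
      thus ?thesis by (intro exI[of _ 1]) auto
    qed
  qed
  then obtain L where L0: "\<And>k. L k > 0" and L: "\<And>k S \<sigma> \<tau> a b c I J K Y. k \<in> {1,2,3} \<Longrightarrow>
    box S \<sigma> \<tau> a b c \<Longrightarrow> a \<le> Y \<Longrightarrow> b \<le> Y \<Longrightarrow> c \<le> Y \<Longrightarrow> (Y = a \<or> Y = b \<or> Y = c) \<Longrightarrow>
    admissible k I \<Longrightarrow> admissible k J \<Longrightarrow> K \<subseteq> {1..5} \<Longrightarrow>
    real (card S) \<le> L k * real Y powr e *
      (real (\<Prod>i\<in>{1..5} - I. radpart a i) * real (\<Prod>i\<in>{1..5} - J. radpart b i) *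
       real (\<Prod>i\<in>{1..5} - K. radpart c i)) *
      (1 + real (rootpart k a I) * real (rootpart k b J) * real (parts c K) / real Y)"
    by metis
  obtain E where E0: "E > 0" and E: "\<And>S \<sigma> \<tau> a b c I J Y.
    box S \<sigma> \<tau> a b c \<Longrightarrow> a \<le> Y \<Longrightarrow> b \<le> Y \<Longrightarrow> c \<le> Y \<Longrightarrow>
    admissible 3 I \<Longrightarrow> admissible 2 J \<Longrightarrow>
    real (card S) \<le> E * real Y powr e *
      (real (\<Prod>i\<in>{1..5} - I. radpart a i) * real (\<Prod>i\<in>{1..5} - J. radpart b i)) *
      sqrt (real (\<Prod>i\<in>I. radpart a i) * real (\<Prod>i\<in>J. radpart b i) * real (\<Prod>i\<in>{1..5}. radpart c i))"
    using box_energy_bound[OF e, of 3 2] by auto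
  define M where "M = 2 * (L 1 + L 2 + L 3) + E"
  have LM: "2 * L k \<le> M" if "k \<in> {1,2,3}" for k
    using that L0[of 1] L0[of 2] L0[of 3] E0 by (auto simp: M_def)
  have EM: "E \<le> M" using L0[of 1] L0[of 2] L0[of 3] by (simp add: M_def)
  have "real (card S) \<le> M * real Y powr (0.6 + e)"
    if bx: "box S \<sigma> \<tau> a b c" and le: "a \<le> Y" "b \<le> Y" "c \<le> Y" and Ym: "Y = a \<or> Y = b \<or> Y = c" and Y2: "Y \<ge> 2"
      and sv: "saves (radlog Y a) (partlog Y a) (radlog Y b) (partlog Y b) (radlog Y c) (partlog Y c)"
    for S \<sigma> \<tau> a b c and Y :: nat
  proof -
    have Y1: "real Y \<ge> 1" "real Y > 0" using Y2 by auto
    have rp: "real (\<Prod>i\<in>J. radpart n i) = real Y powr (sum (radlog Y n) J)" if "J \<subseteq> {1..5}" for n J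
      using prod_eq_powr_sum_log[OF Y2, of "radpart n" J] finite_subset[OF that] by simp
    from sv show ?thesis unfolding saves_def
    proof
      assume "\<exists>k\<in>{1,2,3}. lattice_saves k (radlog Y a) (partlog Y a) (radlog Y b) (partlog Y b) (radlog Y c) (partlog Y c)"
      then obtain k I J K where k: "k \<in> {1,2,3}" and adm: "admissible k I" "admissible k J" and K: "K \<subseteq> {1..5}"
        and s1: "sum (radlog Y a) ({1..5} - I) + sum (radlog Y b) ({1..5} - J) + sum (radlog Y c) ({1..5} - K) \<le> 0.6"
        and s2: "sum (radlog Y a) ({1..5} - I) + sum (radlog Y b) ({1..5} - J) + sum (radlog Y c) ({1..5} - K)
          + (sum (partlog Y a) I + sum (partlog Y b) J) / real k + sum (partlog Y c) K \<le> 1.6"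
        unfolding lattice_saves_def by blast
      define s where "s = sum (radlog Y a) ({1..5} - I) + sum (radlog Y b) ({1..5} - J) + sum (radlog Y c) ({1..5} - K)"
      define t where "t = (sum (partlog Y a) I + sum (partlog Y b) J) / real k + sum (partlog Y c) K"
      have k0: "k > 0" using k by auto
      have P: "real (\<Prod>i\<in>{1..5} - I. radpart a i) * real (\<Prod>i\<in>{1..5} - J. radpart b i) *
       real (\<Prod>i\<in>{1..5} - K. radpart c i) = real Y powr s"
        by (simp only: rp[OF Diff_subset] s_def powr_add)
      have "real (parts c K) = real Y powr (sum (partlog Y c) K)"
        unfolding parts_def using prod_eq_powr_sum_log[OF Y2, of "part c" K] finite_subset[OF K] by simp
      hence Q: "real (rootpart k a I) * real (rootpart k b J) * real (parts c K) / real Y = real Y powr (t - 1)"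
        using Y1 by (simp add: rootpart_eq_powr[OF Y2 adm(1) k0] rootpart_eq_powr[OF Y2 adm(2) k0] t_def
            powr_diff powr_add add_divide_distrib)
      have "real (card S) \<le> L k * real Y powr e * real Y powr s * (1 + real Y powr (t - 1))"
        using L[OF k bx le Ym adm K] unfolding P Q .
      also have "\<dots> = L k * real Y powr e * (real Y powr s + real Y powr (s + t - 1))"
        by (simp add: algebra_simps flip: powr_add)
      also have "\<dots> \<le> L k * real Y powr e * (real Y powr 0.6 + real Y powr 0.6)"
      proof (intro mult_left_mono add_mono powr_mono)
        show "s \<le> 0.6" using s1 by (simp add: s_def)
        show "s + t - 1 \<le> 0.6" using s2 by (simp add: s_def t_def)
      qed (use Y1 L0[of k] in auto)
      also have "\<dots> = (2 * L k) * real Y powr (0.6 + e)" by (simp add: powr_add)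
      also have "\<dots> \<le> M * real Y powr (0.6 + e)" using LM[OF k] by (intro mult_right_mono) auto
      finally show ?thesis .
    next
      assume "energy_saves (radlog Y a) (radlog Y b) (radlog Y c)"
      hence s1: "sum (radlog Y a) ({1..5} - {3}) + sum (radlog Y b) ({1..5} - {2,4})
        + (sum (radlog Y a) {3} + sum (radlog Y b) {2,4} + sum (radlog Y c) {1..5}) / 2 \<le> 0.6"
        unfolding energy_saves_def .
      define s where "s = sum (radlog Y a) ({1..5} - {3}) + sum (radlog Y b) ({1..5} - {2,4})"
      define t where "t = sum (radlog Y a) {3} + sum (radlog Y b) {2,4} + sum (radlog Y c) {1..5}"
      have st: "s + t / 2 \<le> 0.6" using s1 by (simp add: s_def t_def)
      have P: "real (\<Prod>i\<in>{1..5} - {3}. radpart a i) * real (\<Prod>i\<in>{1..5} - {2,4}. radpart b i) = real Y powr s"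
        by (simp only: rp[OF Diff_subset] s_def powr_add)
      have Q: "real (\<Prod>i\<in>{3}. radpart a i) * real (\<Prod>i\<in>{2,4}. radpart b i) * real (\<Prod>i\<in>{1..5}. radpart c i) = real Y powr t"
      proof -
        have "{3} \<subseteq> {1..5::nat}" "{2,4} \<subseteq> {1..5::nat}" by auto
        thus ?thesis by (simp only: rp[of "{3}"] rp[of "{2,4}"] rp[OF subset_refl] t_def powr_add)
      qed
      have "admissible 3 {3}" "admissible 2 {2,4}" by (auto simp: admissible_def)
      hence "real (card S) \<le> E * real Y powr e * real Y powr s * sqrt (real Y powr t)"
        using E[OF bx le, of "{3}" "{2,4}"] unfolding P Q by blast
      also have "sqrt (real Y powr t) = real Y powr (t / 2)"
        by (simp add: powr_half_sqrt_powr)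
      also have "E * real Y powr e * real Y powr s * real Y powr (t / 2) = E * real Y powr (e + (s + t / 2))"
        by (simp add: powr_add)
      also have "\<dots> \<le> M * real Y powr (0.6 + e)"
        using EM E0 st Y1 by (intro mult_mono powr_mono) auto
      finally show ?thesis .
    qed
  qed
  moreover have "M > 0" using E0 EM by linarith
  ultimately show ?thesis by blast
qed

section \<open>Permuting the terms of the equation\<close>

lemma box_swap_left:
  assumes "box S \<sigma> \<tau> a b c"
  shows "box ((\<lambda>(x, y, z). (y, x, z)) ` S) \<tau> \<sigma> b a c"
    "card ((\<lambda>(x, y, z). (y, x, z)) ` S) = card S"
  using assms by (auto simp: box_def coprime_commute intro!: card_image inj_onI)

text \<open>The relation is solved for y by multiplying it with \<open>\<tau>\<close>, whose square
  is 1.\<close>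

lemma box_swap_right:
  assumes "box S \<sigma> \<tau> a b c"
  shows "box ((\<lambda>(x, y, z). (x, z, y)) ` S) (- (\<sigma> * \<tau>)) \<tau> a c b"
    "card ((\<lambda>(x, y, z). (x, z, y)) ` S) = card S"
proof -
  have "\<bar>\<tau>\<bar> = 1" using assms by (simp add: box_def)
  hence "\<tau> * \<tau> = 1" by (metis abs_mult_self_eq mult_1)
  have "y = - (\<sigma> * \<tau>) * x + \<tau> * z" if "z = \<sigma> * x + \<tau> * y" for x y z :: int
  proof -
    have "- (\<sigma> * \<tau>) * x + \<tau> * z = (\<tau> * \<tau>) * y" unfolding that by (simp only: algebra_simps) simp
    thus ?thesis unfolding \<open>\<tau> * \<tau> = 1\<close> by simp
  qed
  thus "box ((\<lambda>(x, y, z). (x, z, y)) ` S) (- (\<sigma> * \<tau>)) \<tau> a c b"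
    using assms by (auto simp: box_def coprime_commute abs_mult)
  show "card ((\<lambda>(x, y, z). (x, z, y)) ` S) = card S" by (auto intro!: card_image inj_onI)
qed

lemma box_some_saving_bound:
  fixes e :: real
  assumes e: "e > 0"
  shows "\<exists>M>0. \<forall>S \<sigma> \<tau> a b c (Y::nat). box S \<sigma> \<tau> a b c \<longrightarrow> a \<le> Y \<longrightarrow> b \<le> Y \<longrightarrow> c \<le> Y \<longrightarrow>
    (Y = a \<or> Y = b \<or> Y = c) \<longrightarrow> Y \<ge> 2 \<longrightarrow>
    some_saves (radlog Y a) (partlog Y a) (radlog Y b) (partlog Y b) (radlog Y c) (partlog Y c) \<longrightarrow>
    real (card S) \<le> M * real Y powr (0.6 + e)"
proof -
  obtain M where M0: "M > 0" and M: "\<And>S \<sigma> \<tau> a b c Y. box S \<sigma> \<tau> a b c \<Longrightarrow> a \<le> Y \<Longrightarrow> b \<le> Y \<Longrightarrow> c \<le> Y \<Longrightarrow>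
    Y = a \<or> Y = b \<or> Y = c \<Longrightarrow> Y \<ge> 2 \<Longrightarrow>
    saves (radlog Y a) (partlog Y a) (radlog Y b) (partlog Y b) (radlog Y c) (partlog Y c) \<Longrightarrow>
    real (card S) \<le> M * real Y powr (0.6 + e)"
    using box_saving_bound[OF e] by blast
  have "real (card S) \<le> M * real Y powr (0.6 + e)"
    if bx: "box S \<sigma> \<tau> a b c" and le: "a \<le> Y" "b \<le> Y" "c \<le> Y" and Ym: "Y = a \<or> Y = b \<or> Y = c" and Y2: "Y \<ge> 2"
      and sv: "some_saves (radlog Y a) (partlog Y a) (radlog Y b) (partlog Y b) (radlog Y c) (partlog Y c)"
    for S \<sigma> \<tau> a b c and Y :: nat
  proof -
    \<comment> \<open>The two transpositions generate all six orders; \<open>b2\<close> to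
      \<open>b6\<close> run through those other than the given one.\<close>
    note b2 = box_swap_right[OF bx]
    note b3 = box_swap_left[OF bx]
    note b4 = box_swap_right[OF b3(1)]
    note b5 = box_swap_left[OF b2(1)]
    note b6 = box_swap_left[OF b4(1)]
    from sv show ?thesis
      unfolding some_saves_def
      using M[OF bx le _ Y2] M[OF b2(1) le(1,3,2) _ Y2] M[OF b3(1) le(2,1,3) _ Y2]
        M[OF b4(1) le(2,3,1) _ Y2] M[OF b5(1) le(3,1,2) _ Y2] M[OF b6(1) le(3,2,1) _ Y2]
        Ym b2(2) b3(2) b4(2) b5(2) b6(2) by metis
  qed
  thus ?thesis using M0 by blast
qed

section \<open>Dyadic boxes for abc triples and the final count\<close>

lemma rad_mult_coprime:
  assumes "m > 0" "n > 0" "coprime m (n::nat)"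
  shows "rad (m * n) = rad m * rad n"
proof -
  have "prime_factors (m * n) = prime_factors m \<union> prime_factors n"
    using assms by (simp add: prime_factors_product)
  moreover have "prime_factors m \<inter> prime_factors n = {}"
    using assms(3) by (auto simp: in_prime_factors_iff) (metis coprime_common_divisor_nat not_prime_1)
  ultimately show ?thesis by (simp add: rad_def prod.union_disjoint)
qed

text \<open>A common divisor of two of the terms divides the third because a + b = c, so the joint
  gcd controls every pair.\<close>

lemma abc_triple_coprime:
  assumes "abc_triple l a b c"
  shows "coprime a b" "coprime a c" "coprime b c"
proof -
  have abc: "a + b = c" and g: "gcd a (gcd b c) = 1" using assms by (auto simp: abc_triple_def)
  have "gcd a b dvd gcd a (gcd b c)" using abc by (metis dvd_add gcd_dvd1 gcd_dvd2 gcd_greatest)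
  thus ab: "coprime a b" using g by (simp add: coprime_iff_gcd_eq_1)
  show "coprime a c" using ab unfolding abc[symmetric] by (simp add: coprime_iff_gcd_eq_1)
  have "gcd b (b + a) = gcd a b" by (metis gcd.commute gcd_add2)
  thus "coprime b c" using ab abc by (metis add.commute coprime_iff_gcd_eq_1)
qed

lemma log_floor_eq_imp_le:
  assumes "p > 0" "q > 0" "nat \<lfloor>log 2 (real p)\<rfloor> = nat \<lfloor>log 2 (real q)\<rfloor>"
  shows "p \<le> 2 * q"
proof -
  have "0 \<le> log 2 (real p)" "0 \<le> log 2 (real q)" using assms by auto
  hence "\<lfloor>log 2 (real p)\<rfloor> = \<lfloor>log 2 (real q)\<rfloor>" using assms(3) by (simp add: eq_nat_nat_iff)
  hence "log 2 (real p) \<le> log 2 (real q) + 1" by linarith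
  also have "\<dots> = log 2 (2 * real q)" using assms by (simp add: log_mult)
  finally have "real p \<le> 2 * real q" using assms by simp
  thus ?thesis by linarith
qed

lemma profile_logs:
  assumes "n > 0" "n \<le> Y" "Y \<ge> 2"
  shows "profile (radlog Y n) (partlog Y n)"
proof -
  have r1: "1 \<le> real (radpart n i)" for i using radpart_pos[of n i] by linarith
  have "partlog Y n i = real i * radlog Y n i" if "i \<in> {1..4}" for i
    using that r1[of i] by (simp add: part_eq_power log_nat_power)
  moreover have "5 * radlog Y n 5 \<le> partlog Y n 5"
  proof -
    have "5 * radlog Y n 5 = log (real Y) (real (radpart n 5 ^ 5))"
      using r1[of 5] by (simp add: log_nat_power)
    also have "\<dots> \<le> partlog Y n 5"
    proof (rule log_mono)
      show "real (radpart n 5 ^ 5) \<le> real (part n 5)"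
        using radpart_power_le_part[of n] by (simp only: of_nat_le_iff)
    qed (use assms(3) r1[of 5] in auto)
    finally show ?thesis .
  qed
  moreover have "(\<Sum>i\<in>{1..5}. partlog Y n i) \<le> 1"
  proof -
    have "real (parts n {1..5}) = real Y powr (\<Sum>i\<in>{1..5}. partlog Y n i)"
      unfolding parts_def by (rule prod_eq_powr_sum_log[OF assms(3)]) auto
    hence "real Y powr (\<Sum>i\<in>{1..5}. partlog Y n i) = real n"
      unfolding parts_all[OF assms(1)] by (rule sym)
    also have "\<dots> \<le> real Y powr 1" using assms by simp
    finally show ?thesis using assms(3) powr_le_cancel_iff[of "real Y" _ 1] by simp
  qed
  moreover have "0 \<le> radlog Y n i" for i using r1[of i] assms(3) by simp
  ultimately show ?thesis by (simp add: profile_def)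
qed

text \<open>Ten integers for each number, hence thirty for a triple: this is the exponent of the
  logarithm in the final count.\<close>

definition dyadic_key :: "nat \<Rightarrow> nat \<Rightarrow> nat \<times> nat" where
  "dyadic_key n = (\<lambda>i\<in>{1..5}. (nat \<lfloor>log 2 (real (part n i))\<rfloor>, nat \<lfloor>log 2 (real (radpart n i))\<rfloor>))"

lemma dyadic_key_eq_imp_near:
  assumes "m > 0" "dyadic_key m = dyadic_key n"
  shows "near m n"
proof -
  have "part m i \<le> 2 * part n i \<and> part n i \<le> 2 * part m i \<and> radpart m i \<le> 2 * radpart n i"
    if "i \<in> {1..5}" for i
  proof -
    have "nat \<lfloor>log 2 (real (part m i))\<rfloor> = nat \<lfloor>log 2 (real (part n i))\<rfloor>"
      "nat \<lfloor>log 2 (real (radpart m i))\<rfloor> = nat \<lfloor>log 2 (real (radpart n i))\<rfloor>"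
      using fun_cong[OF assms(2), of i] that by (auto simp: dyadic_key_def)
    thus ?thesis by (auto intro!: log_floor_eq_imp_le)
  qed
  thus ?thesis using assms(1) by (auto simp: near_def)
qed

lemma dyadic_key_range:
  assumes "n > 0" "real n \<le> X"
  shows "dyadic_key n \<in> PiE {1..5} (\<lambda>_. {..nat \<lfloor>log 2 X\<rfloor>} \<times> {..nat \<lfloor>log 2 X\<rfloor>})"
proof -
  have "real (part n i) \<le> X \<and> real (radpart n i) \<le> X" if "i \<in> {1..5}" for i
  proof -
    have "part n i dvd parts n {1..5}" unfolding parts_def using that by (intro dvd_prodI) auto
    hence "part n i \<le> n" using assms parts_all[of n] by (simp add: dvd_imp_le)
    moreover have "radpart n i \<le> part n i"
      unfolding radpart_def part_def
      by (intro prod_mono) (auto simp: expclass_def prime_factors_multiplicity self_le_power prime_ge_Suc_0_nat)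
    ultimately show ?thesis using assms by linarith
  qed
  moreover have "nat \<lfloor>log 2 (real p)\<rfloor> \<le> nat \<lfloor>log 2 X\<rfloor>" if "p > 0" "real p \<le> X" for p
    using that by (intro nat_mono floor_mono) simp
  ultimately show ?thesis by (auto simp: dyadic_key_def)
qed

lemma log_power_bound:
  fixes e :: real
  assumes e: "e > 0"
  shows "\<exists>M>0. \<forall>X\<ge>1. (log 2 X + 1) ^ n \<le> M * X powr e"
proof -
  \<comment> \<open>Chosen so that d * n <= e; the added 1 covers n = 0.\<close>
  define d where "d = e / (real n + 1)"
  have d: "d > 0" using e by (simp add: d_def)
  define A where "A = 1 / (d * ln 2) + 1"
  have A: "A > 0" using d by (simp add: A_def add_pos_pos)
  have "(log 2 X + 1) ^ n \<le> A ^ n * X powr e" if X: "X \<ge> 1" for X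
  proof -
    have X1: "1 \<le> X powr d" using X d by (simp add: ge_one_powr_ge_zero)
    have "log 2 X \<le> X powr d / d / ln 2"
      unfolding log_def using ln_powr_bound[OF X d] by (intro divide_right_mono) auto
    hence "log 2 X + 1 \<le> A * X powr d" using X1 by (simp add: A_def algebra_simps)
    hence "(log 2 X + 1) ^ n \<le> (A * X powr d) ^ n" using X by (intro power_mono) auto
    also have "\<dots> = A ^ n * X powr (d * real n)"
      using X by (simp add: power_mult_distrib powr_powr flip: powr_realpow)
    also have "\<dots> \<le> A ^ n * X powr e"
      using X A e by (intro mult_left_mono powr_mono) (auto simp: d_def field_simps)
    finally show ?thesis .
  qed
  thus ?thesis using A by (intro exI[of _ "A ^ n"]) auto
qed

theorem theorem1p3:
  fixes l :: real
  assumes "l \<in> {0<..<1}"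
  shows "\<forall>\<epsilon>>0. \<exists>K. \<forall>X\<ge>1.
    \<bar>real (abc_count l X)\<bar> \<le> K * X powr (0.6 + \<epsilon>)"
proof (intro allI impI)
  fix e :: real assume e: "e > 0"
  obtain M where M0: "M > 0" and M: "\<And>S \<sigma> \<tau> a b c Y. box S \<sigma> \<tau> a b c \<Longrightarrow> a \<le> Y \<Longrightarrow> b \<le> Y \<Longrightarrow> c \<le> Y \<Longrightarrow>
    Y = a \<or> Y = b \<or> Y = c \<Longrightarrow> Y \<ge> 2 \<Longrightarrow>
    some_saves (radlog Y a) (partlog Y a) (radlog Y b) (partlog Y b) (radlog Y c) (partlog Y c) \<Longrightarrow>
    real (card S) \<le> M * real Y powr (0.6 + e / 2)"
    using box_some_saving_bound[OF half_gt_zero[OF e]] by blast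
  obtain L where L0: "L > 0" and L: "\<And>X. X \<ge> 1 \<Longrightarrow> (log 2 X + 1) ^ 30 \<le> L * X powr (e / 2)"
    using log_power_bound[of "e / 2" 30] e by auto
  have "\<bar>real (abc_count l X)\<bar> \<le> (L * M) * X powr (0.6 + e)" if X: "X \<ge> 1" for X
  proof -
    define T where "T = {(a, b, c). abc_triple l a b c \<and>
       real a \<in> {1..X} \<and> real b \<in> {1..X} \<and> real c \<in> {1..X}}"
    let ?N = "nat \<lfloor>log 2 X\<rfloor>"
    define P where "P = PiE {1..5::nat} (\<lambda>_. {..?N} \<times> {..?N})"
    define f where "f = (\<lambda>(a, b, c). (dyadic_key a, dyadic_key b, dyadic_key c))"
    define B where "B = nat \<lfloor>X\<rfloor>"
    have finT: "finite T"
      by (rule finite_subset[of _ "{..B} \<times> {..B} \<times> {..B}"]) (auto simp: T_def B_def le_nat_floor)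
    have finP: "finite P" unfolding P_def by (intro finite_PiE) auto
    have fib: "real (card {t \<in> T. f t = k}) \<le> M * X powr (0.6 + e / 2)" for k
    proof (cases "{t \<in> T. f t = k} = {}")
      case True
      show ?thesis unfolding True using M0 by simp
    next
      case False
      \<comment> \<open>Any member of the fibre serves as reference triple. Its largest entry is
        \<open>c\<close>, which becomes the base of the logarithms.\<close>
      then obtain t where "t \<in> T \<and> f t = k" by blast
      then obtain a b c where t: "(a, b, c) \<in> T" "f (a, b, c) = k" by (cases t) auto
      have tr: "abc_triple l a b c" and cX: "real c \<le> X" using t by (auto simp: T_def)
      have abc: "a > 0" "b > 0" "c > 0" "a + b = c" and rd: "real (rad (a * b * c)) < real c powr l"
        using tr by (auto simp: abc_triple_def)
      have c2: "c \<ge> 2" using abc by linarith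
      have bx: "box {t \<in> T. f t = k} 1 1 a b c"
      proof -
        have "near x a \<and> near y b \<and> near z c \<and> coprime x y \<and> coprime x z \<and> coprime y z \<and>
            int z = 1 * int x + 1 * int y" if "(x, y, z) \<in> {t \<in> T. f t = k}" for x y z
        proof -
          have m: "(x, y, z) \<in> T" "f (x, y, z) = f (a, b, c)" using that t(2) by simp_all
          have tr': "abc_triple l x y z" using m(1) by (simp add: T_def)
          hence "x > 0" "y > 0" "z > 0" "x + y = z" by (auto simp: abc_triple_def)
          moreover have "dyadic_key x = dyadic_key a" "dyadic_key y = dyadic_key b" "dyadic_key z = dyadic_key c"
            using m(2) by (simp_all add: f_def)
          ultimately show ?thesis
            using abc_triple_coprime[OF tr'] dyadic_key_eq_imp_near by auto
        qed
        moreover have "finite {t \<in> T. f t = k}" using finT by simp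
        ultimately show ?thesis using abc unfolding box_def by simp
      qed
      have "sum (radlog c a) {1..5} + sum (radlog c b) {1..5} + sum (radlog c c) {1..5} \<le> 1"
      proof -
        have rl: "real (rad n) = real c powr sum (radlog c n) {1..5}" for n
          unfolding rad_eq_prod_radpart using prod_eq_powr_sum_log[OF c2, of "radpart n" "{1..5}"] by simp
        note co = abc_triple_coprime[OF tr]
        have "rad (a * b * c) = rad a * rad b * rad c"
          using abc co by (simp add: rad_mult_coprime)
        \<comment> \<open>Here l < 1 enters: the radical is below c^l, so the exponents of all
          radical parts add up to less than 1.\<close>
        hence "real c powr (sum (radlog c a) {1..5} + sum (radlog c b) {1..5} + sum (radlog c c) {1..5}) < real c powr l"
          using rd by (simp only: powr_add of_nat_mult rl)
        thus ?thesis using c2 assms by simp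
      qed
      hence "some_saves (radlog c a) (partlog c a) (radlog c b) (partlog c b) (radlog c c) (partlog c c)"
        using abc c2 by (intro some_saves profile_logs) auto
      hence "real (card {t \<in> T. f t = k}) \<le> M * real c powr (0.6 + e / 2)"
        using abc c2 by (intro M[OF bx]) auto
      also have "\<dots> \<le> M * X powr (0.6 + e / 2)"
        using cX M0 e by (intro mult_left_mono powr_mono2) auto
      finally show ?thesis .
    qed
    have "real (card T) \<le> real (card (P \<times> P \<times> P)) * (M * X powr (0.6 + e / 2))"
    proof (rule card_le_fibres[OF finT _ _ fib])
      show "finite (P \<times> P \<times> P)" using finP by simp
      have key: "dyadic_key n \<in> P" if "real n \<in> {1..X}" for n
        unfolding P_def using that by (intro dyadic_key_range) auto
      show "f ` T \<subseteq> P \<times> P \<times> P"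
      proof
        fix k assume "k \<in> f ` T"
        then obtain a b c where "(a, b, c) \<in> T" "k = f (a, b, c)" by auto
        thus "k \<in> P \<times> P \<times> P" using key by (simp add: f_def T_def)
      qed
    qed
    also have "real (card (P \<times> P \<times> P)) = (real ?N + 1) ^ 30"
    proof -
      have "card P = (\<Prod>i\<in>{1..5::nat}. (?N + 1) * (?N + 1))"
        unfolding P_def by (simp only: card_PiE finite_atLeastAtMost card_cartesian_product) simp
      also have "\<dots> = (?N + 1) ^ 5 * (?N + 1) ^ 5" by (simp only: prod_constant power_mult_distrib) simp
      also have "\<dots> = (?N + 1) ^ 10" by (simp flip: power_add)
      finally have "card (P \<times> P \<times> P) = (?N + 1) ^ 10 * ((?N + 1) ^ 10 * (?N + 1) ^ 10)"
        by (simp only: card_cartesian_product)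
      also have "\<dots> = (?N + 1) ^ 30" by (simp flip: power_add)
      finally show ?thesis by (simp add: add.commute)
    qed
    also have "\<dots> \<le> (log 2 X + 1) ^ 30"
      using X by (intro power_mono) auto
    also have "\<dots> \<le> L * X powr (e / 2)" by (rule L[OF X])
    finally have "real (card T) \<le> L * X powr (e / 2) * (M * X powr (0.6 + e / 2))"
      using M0 by (simp add: mult_right_mono)
    also have "\<dots> = (L * M) * (X powr (e / 2) * X powr (0.6 + e / 2))" by simp
    also have "X powr (e / 2) * X powr (0.6 + e / 2) = X powr (0.6 + e)"
      by (simp add: algebra_simps flip: powr_add)
    finally show ?thesis by (simp add: abc_count_def T_def)
  qed
  thus "\<exists>K. \<forall>X\<ge>1. \<bar>real (abc_count l X)\<bar> \<le> K * X powr (0.6 + e)" by blast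
qed

end
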